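(* Let $d>2$, $\Omega\subseteq\mathbb{R}^d$ open, and $2\le k\le d-1$ an odd integer. Let $f\in W^{1,\infty}(\Omega,\mathbb{R}^d)$ and suppose that the a.e.-defined map $x\mapsto\bigwedge^kdf_x$ has a smooth representative $\Omega\to\operatorname{End}(\bigwedge^k\mathbb{R}^d)$ taking values in $\tilde H_{>k}$ at every point. Then $f$ is smooth.
   Context: $\bigwedge^kA$ is the endomorphism of $\bigwedge^k\mathbb{R}^d$ given by $v_1\wedge\dots\wedge v_k\mapsto Av_1\wedge\dots\wedge Av_k$. $\tilde H_{>k}=\{B\in\operatorname{End}(\bigwedge^k\mathbb{R}^d):\operatorname{rank}B>k\}$. *)

theory Defs
  imports "HOL-Analysis.Analysis"
begin

fun ipd :: "'n::finite list \<Rightarrow> (real^'n \<Rightarrow> real) \<Rightarrow> real^'n \<Rightarrow> real" where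
  "ipd [] g = g"
| "ipd (j # js) g = (\<lambda>x. deriv (\<lambda>t. ipd js g (x + t *\<^sub>R axis j 1)) 0)"

definition smooth_real_on :: "(real^'n::finite) set \<Rightarrow> (real^'n \<Rightarrow> real) \<Rightarrow> bool" where
  "smooth_real_on S g \<longleftrightarrow>
     (\<forall>js. continuous_on S (ipd js g) \<and>
        (\<forall>j. \<forall>x\<in>S. \<exists>D. ((\<lambda>t. ipd js g (x + t *\<^sub>R axis j 1)) has_real_derivative D) (at 0)))"

definition smooth_vec_on :: "(real^'n::finite) set \<Rightarrow> (real^'n \<Rightarrow> real^'m::finite) \<Rightarrow> bool" where
  "smooth_vec_on S f \<longleftrightarrow> (\<forall>i. smooth_real_on S (\<lambda>x. f x $ i))"

definition smooth_mat_on :: "(real^'n::finite) set \<Rightarrow> (real^'n \<Rightarrow> real^'b::finite^'a::finite) \<Rightarrow> bool" where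
  "smooth_mat_on S F \<longleftrightarrow> (\<forall>i j. smooth_real_on S (\<lambda>x. F x $ i $ j))"

definition test_fun :: "(real^'n::finite) set \<Rightarrow> (real^'n \<Rightarrow> real) \<Rightarrow> bool" where
  "test_fun \<Omega> \<phi> \<longleftrightarrow> smooth_real_on UNIV \<phi> \<and>
     (\<exists>K. compact K \<and> K \<subseteq> \<Omega> \<and> (\<forall>x. x \<notin> K \<longrightarrow> \<phi> x = 0))"

definition W1inf_jac :: "(real^'n::finite) set \<Rightarrow> (real^'n \<Rightarrow> real^'m::finite)
    \<Rightarrow> (real^'n \<Rightarrow> real^'n^'m) \<Rightarrow> bool" where
  "W1inf_jac \<Omega> f G \<longleftrightarrow>
     (\<forall>i. (\<lambda>x. f x $ i) \<in> borel_measurable (lebesgue_on \<Omega>) \<and>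
          (\<exists>C. AE x in lebesgue_on \<Omega>. \<bar>f x $ i\<bar> \<le> C)) \<and>
     (\<forall>i j. (\<lambda>x. G x $ i $ j) \<in> borel_measurable (lebesgue_on \<Omega>) \<and>
          (\<exists>C. AE x in lebesgue_on \<Omega>. \<bar>G x $ i $ j\<bar> \<le> C)) \<and>
     (\<forall>\<phi>. test_fun \<Omega> \<phi> \<longrightarrow> (\<forall>i j.
          (LINT x|lebesgue_on \<Omega>. f x $ i * ipd [j] \<phi> x)
            = - (LINT x|lebesgue_on \<Omega>. G x $ i $ j * \<phi> x)))"

text \<open>Matrix of the k-th exterior power of A in the standard basis e_I = e_i1 \<and> ... \<and> e_ik
  (i1 < ... < ik), indexed by subsets of the index type.  Entry (I,J) is the minor
  det A[I,J]; entries with card I \<noteq> k or card J \<noteq> k are 0 (they lie outside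
  \<and>^k R^d).\<close>
definition ext_pow :: "nat \<Rightarrow> real^('n::{finite,linorder})^('n::{finite,linorder}) \<Rightarrow> real^('n::{finite,linorder} set)^('n::{finite,linorder} set)" where
  "ext_pow k A = (\<chi> I J. if card I = k \<and> card J = k then
      (\<Sum>p\<in>{p. p permutes {..<k}}. of_int (sign p) *
          (\<Prod>i<k. A $ (sorted_list_of_set I ! p i) $ (sorted_list_of_set J ! i)))
      else 0)"

definition is_ext_endo :: "nat \<Rightarrow> real^('n::finite set)^('n set) \<Rightarrow> bool" where
  "is_ext_endo k B \<longleftrightarrow> (\<forall>I J. (card I \<noteq> k \<or> card J \<noteq> k) \<longrightarrow> B $ I $ J = 0)"

end

theory Submission
  imports Defs "Jordan_Normal_Form.Determinant"
begin

text \<open>The \<open>k\<close>-minors of a matrix \<open>A\<close> of rank greater than \<open>k\<close> determine \<open>A\<close> smoothly: they contain the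
  adjugate of every \<open>(k + 1) \<times> (k + 1)\<close> submatrix \<open>M\<close>, and \<open>det (adj M) = (det M) ^ k\<close> recovers \<open>det M\<close>
  by an odd root, which is smooth away from \<open>0\<close>; then \<open>det M * adj (adj M) = det (adj M) * M\<close> recovers \<open>M\<close>.
  Since the smooth representative takes values in \<open>k\<close>-th exterior powers of uniformly bounded
  matrices almost everywhere, compactness makes it an exterior power at every point, so the weak Jacobian
  has a smooth representative. A function whose weak gradient is continuous satisfies the
  fundamental theorem of calculus along almost every segment; averaging over segments with a bump function
  gives a continuously differentiable representative, whose gradient is smooth.\<close>

no_notation vec_index (infixl \<open>$\<close> 100)
no_notation scalar_prod (infix \<open>\<bullet>\<close> 70)
hide_const (open) Matrix.vec

section \<open>Smooth functions\<close>

text \<open>The hypothesis concerns the rank of the exterior power, whereas the reconstruction needs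
  \<open>rank A > k\<close>. The link is that a matrix of rank at most \<open>k\<close> factors
  through R^k, so its \<open>k\<close>-th exterior power factors through a line. Odd
  \<open>k\<close> is what lets \<open>(det M) ^ k\<close> determine \<open>det M\<close>; for even
  \<open>k\<close> the matrices \<open>A\<close> and \<open>- A\<close> have the same exterior
  power. Submatrices are formed with arbitrary vectors, from the numbers
  \<open>u \<bullet> (A *v v)\<close>, and not only with coordinates: the reconstruction works for
  forms that are nonzero at the point, and an entry that vanishes there is a difference of two such
  forms. The reconstruction uses only the values of the exterior power, so the matrix may be picked
  at each point without any regularity; smoothness is then forced. On the analytic side the obstacle
  is that the null set on which the increment formula fails depends on the direction of the segment.
  Averaging over the directions removes this dependence.\<close>

abbreviation has_partial :: "(real^'n::finite \<Rightarrow> real) \<Rightarrow> 'n \<Rightarrow> real \<Rightarrow> real^'n \<Rightarrow> bool" where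
  "has_partial g j d x \<equiv> ((\<lambda>t. g (x + t *\<^sub>R axis j 1)) has_real_derivative d) (at 0)"

text \<open>Induction on the order replaces the lists of directions in \<open>ipd\<close>. A partial
  derivative is any \<open>h\<close> with the right values on \<open>S\<close>, so explicit formulas
  may be used that differ from \<open>deriv\<close> off \<open>S\<close>.\<close>

primrec Ck :: "nat \<Rightarrow> (real^'n::finite) set \<Rightarrow> (real^'n \<Rightarrow> real) \<Rightarrow> bool" where
  "Ck 0 S g = continuous_on S g"
| "Ck (Suc m) S g = (continuous_on S g \<and> (\<forall>j. \<exists>h. Ck m S h \<and> (\<forall>x\<in>S. has_partial g j (h x) x)))"

lemma Ck_continuous_on: "Ck m S g \<Longrightarrow> continuous_on S g"
  by (cases m) auto

lemma Ck_SucE: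
  assumes "Ck (Suc m) S g"
  obtains h where "Ck m S h" "\<And>x. x \<in> S \<Longrightarrow> has_partial g j (h x) x"
  using assms unfolding Ck.simps by blast

lemma Ck_SucI:
  assumes "continuous_on S g" "\<And>j. Ck m S (h j)"
    "\<And>j x. x \<in> S \<Longrightarrow> has_partial g j (h j x) x"
  shows "Ck (Suc m) S g"
  using assms by auto

lemma has_partial_cong:
  assumes "open S" "x \<in> S" "\<And>x. x \<in> S \<Longrightarrow> f x = g x"
  shows "has_partial f j d x \<longleftrightarrow> has_partial g j d x"
proof -
  have "open ((\<lambda>t. x + t *\<^sub>R axis j (1::real)) -` S)"
    by (intro open_vimage assms(1) continuous_intros)
  then have "\<forall>\<^sub>F t in nhds 0. x + t *\<^sub>R axis j (1::real) \<in> S"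
    using assms(2) by (auto dest: eventually_nhds_in_open[where x = 0])
  then have "\<forall>\<^sub>F t in nhds 0. f (x + t *\<^sub>R axis j 1) = g (x + t *\<^sub>R axis j 1)"
    by (rule eventually_mono) (rule assms(3))
  then show ?thesis by (intro DERIV_cong_ev) auto
qed

lemma Ck_cong:
  assumes "open S" "\<And>x. x \<in> S \<Longrightarrow> f x = g x"
  shows "Ck m S f \<longleftrightarrow> Ck m S g"
proof -
  have "continuous_on S f \<longleftrightarrow> continuous_on S g"
    using assms(2) by (intro continuous_on_cong) auto
  moreover have "has_partial f j d x \<longleftrightarrow> has_partial g j d x" if "x \<in> S" for x j d
    by (rule has_partial_cong[OF assms(1) that assms(2)])
  ultimately show ?thesis by (cases m) (simp_all cong: ball_cong)
qed

lemma Ck_SucD: "Ck (Suc m) S g \<Longrightarrow> Ck m S g"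
proof (induction m arbitrary: g)
  case 0
  then show ?case unfolding Ck.simps by blast
next
  case (Suc m)
  have "\<forall>j. \<exists>h. Ck (Suc m) S h \<and> (\<forall>x\<in>S. has_partial g j (h x) x)"
    using Suc.prems unfolding Ck.simps(2)[of "Suc m"] by (rule conjunct2)
  from choice[OF this] obtain h where
    h: "\<And>j. Ck (Suc m) S (h j)" "\<And>j x. x \<in> S \<Longrightarrow> has_partial g j (h j x) x"
    by blast
  show ?case
    by (rule Ck_SucI[OF Ck_continuous_on[OF Suc.prems] Suc.IH[OF h(1)] h(2)])
qed

text \<open>Uniqueness of derivatives identifies each witness \<open>h\<close> with
  \<open>ipd (j # js) g\<close> on \<open>S\<close>. Openness lets agreement on \<open>S\<close>
  pass to the next partial derivative, which looks at points near \<open>x\<close>.\<close>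

lemma smooth_real_on_iff_Ck:
  assumes "open S"
  shows "smooth_real_on S g \<longleftrightarrow> (\<forall>m. Ck m S g)"
proof
  assume g: "smooth_real_on S g"
  have "Ck m S (ipd js g)" for m js
  proof (induction m arbitrary: js)
    case (Suc m)
    have "has_partial (ipd js g) j (ipd (j # js) g x) x" if "x \<in> S" for j x
      using g that unfolding smooth_real_on_def by (auto simp: DERIV_deriv_iff_has_field_derivative)
    moreover have "continuous_on S (ipd js g)"
      using g by (simp add: smooth_real_on_def)
    ultimately show ?case using Suc.IH by (intro Ck_SucI[where h = "\<lambda>j. ipd (j # js) g"])
  qed (use g in \<open>auto simp: smooth_real_on_def\<close>)
  from this[of _ "[]"] show "\<forall>m. Ck m S g" by simp
next
  assume g: "\<forall>m. Ck m S g"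
  have Ck_ipd: "\<forall>m. Ck m S (ipd js g)" for js
  proof (induction js)
    case (Cons j js)
    show ?case
    proof
      fix m
      from Cons obtain h where h: "Ck m S h" "\<And>x. x \<in> S \<Longrightarrow> has_partial (ipd js g) j (h x) x"
        using Ck_SucE[where g = "ipd js g" and j = j] by metis
      have "ipd (j # js) g x = h x" if "x \<in> S" for x
        using DERIV_imp_deriv[OF h(2)[OF that]] by simp
      then show "Ck m S (ipd (j # js) g)"
        using h(1) Ck_cong[OF assms, of "ipd (j # js) g" h] by blast
    qed
  qed (use g in simp)
  show "smooth_real_on S g" unfolding smooth_real_on_def
  proof (intro allI conjI ballI)
    fix js j x assume "x \<in> S"
    then show "\<exists>D. has_partial (ipd js g) j D x"
      using Ck_SucE[OF Ck_ipd[of js, rule_format, of "Suc 0"]] by metis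
  qed (use Ck_ipd in \<open>blast intro: Ck_continuous_on\<close>)
qed

lemma Ck_subset: "Ck m S g \<Longrightarrow> T \<subseteq> S \<Longrightarrow> Ck m T g"
proof (induction m arbitrary: g)
  case (Suc m)
  have "\<exists>h. Ck m T h \<and> (\<forall>x\<in>T. has_partial g j (h x) x)" for j
    using Ck_SucE[OF Suc.prems(1), of j] Suc.IH[OF _ Suc.prems(2)] Suc.prems(2) by (metis subsetD)
  then show ?case using Suc.prems continuous_on_subset[of S g T] by simp
qed (auto intro: continuous_on_subset)

lemma Ck_const: "Ck m S (\<lambda>x. c)"
  by (induction m arbitrary: c) (simp, rule Ck_SucI[where h = "\<lambda>_ _. 0"], simp_all)

lemma Ck_coord: "Ck m S (\<lambda>x. x $ i)"
proof (cases m)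
  case (Suc n)
  have "has_partial (\<lambda>x. x $ i) j (axis j 1 $ i) x" for j x
    by (auto intro!: derivative_eq_intros)
  then show ?thesis unfolding Suc
    by (intro Ck_SucI[where h = "\<lambda>j x. axis j 1 $ i"] Ck_const continuous_intros)
qed (simp add: continuous_on_component)

lemma Ck_add: "Ck m S f \<Longrightarrow> Ck m S g \<Longrightarrow> Ck m S (\<lambda>x. f x + g x)"
proof (induction m arbitrary: f g)
  case (Suc m)
  show ?case
  proof (subst Ck.simps(2), intro conjI allI)
    fix j
    obtain f' g' where "Ck m S f'" "\<And>x. x \<in> S \<Longrightarrow> has_partial f j (f' x) x"
      "Ck m S g'" "\<And>x. x \<in> S \<Longrightarrow> has_partial g j (g' x) x"
      using Ck_SucE[OF Suc.prems(1)] Ck_SucE[OF Suc.prems(2)] by metis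
    then show "\<exists>h. Ck m S h \<and> (\<forall>x\<in>S. has_partial (\<lambda>x. f x + g x) j (h x) x)"
      by (intro exI[of _ "\<lambda>x. f' x + g' x"]) (auto intro: Suc.IH DERIV_add)
  qed (use Suc.prems in \<open>auto intro: continuous_on_add\<close>)
qed (auto intro: continuous_on_add)

lemma Ck_mult: "Ck m S f \<Longrightarrow> Ck m S g \<Longrightarrow> Ck m S (\<lambda>x. f x * g x)"
proof (induction m arbitrary: f g)
  case (Suc m)
  show ?case
  proof (subst Ck.simps(2), intro conjI allI)
    fix j
    obtain f' g' where fg: "Ck m S f'" "\<And>x. x \<in> S \<Longrightarrow> has_partial f j (f' x) x"
      "Ck m S g'" "\<And>x. x \<in> S \<Longrightarrow> has_partial g j (g' x) x"
      using Ck_SucE[OF Suc.prems(1)] Ck_SucE[OF Suc.prems(2)] by metis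
    have "has_partial (\<lambda>x. f x * g x) j (f' x * g x + f x * g' x) x" if "x \<in> S" for x
      using DERIV_mult[OF fg(2)[OF that] fg(4)[OF that]]
      by (simp add: algebra_simps)
    moreover have "Ck m S (\<lambda>x. f' x * g x + f x * g' x)"
      using fg Suc.prems[THEN Ck_SucD] by (intro Ck_add Suc.IH)
    ultimately show "\<exists>h. Ck m S h \<and> (\<forall>x\<in>S. has_partial (\<lambda>x. f x * g x) j (h x) x)"
      by blast
  qed (use Suc.prems in \<open>auto intro: continuous_on_mult\<close>)
qed (auto intro: continuous_on_mult)

lemma Ck_sum: "(\<And>i. i \<in> I \<Longrightarrow> Ck m S (f i)) \<Longrightarrow> Ck m S (\<lambda>x. \<Sum>i\<in>I. f i x)"
  by (induction I rule: infinite_finite_induct) (auto intro: Ck_const Ck_add)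

lemma Ck_prod: "(\<And>i. i \<in> I \<Longrightarrow> Ck m S (f i)) \<Longrightarrow> Ck m S (\<lambda>x. \<Prod>i\<in>I. f i x)"
  by (induction I rule: infinite_finite_induct) (auto intro: Ck_const Ck_mult)

lemma Ck_power: "Ck m S f \<Longrightarrow> Ck m S (\<lambda>x. f x ^ n)"
  by (induction n) (auto intro: Ck_const Ck_mult)

text \<open>The induction step shared by inverses, odd roots and \<open>flat_exp\<close>: in each
  case \<open>\<phi>'\<close> is built from functions of the same kind, so the induction hypothesis
  supplies \<open>IH\<close>.\<close>

lemma Ck_Suc_comp:
  assumes f: "Ck (Suc m) S f"
    and D: "\<And>x. x \<in> S \<Longrightarrow> (\<phi> has_real_derivative \<phi>' (f x)) (at (f x))"
    and IH: "Ck m S (\<lambda>x. \<phi>' (f x))"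
  shows "Ck (Suc m) S (\<lambda>x. \<phi> (f x))"
proof (subst Ck.simps(2), intro conjI allI)
  have "continuous_on (f ` S) \<phi>"
    using D by (intro continuous_at_imp_continuous_on) (auto intro: DERIV_isCont)
  then show "continuous_on S (\<lambda>x. \<phi> (f x))"
    using continuous_on_compose2[of "f ` S" \<phi> S f] f by auto
  fix j
  obtain f' where f': "Ck m S f'" "\<And>x. x \<in> S \<Longrightarrow> has_partial f j (f' x) x"
    using Ck_SucE[OF f] by metis
  have "has_partial (\<lambda>x. \<phi> (f x)) j (\<phi>' (f x) * f' x) x" if "x \<in> S" for x
    using D[OF that] f'(2) that by (intro DERIV_chain2[where f = \<phi>]) auto
  then show "\<exists>h. Ck m S h \<and> (\<forall>x\<in>S. has_partial (\<lambda>x. \<phi> (f x)) j (h x) x)"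
    using f'(1) IH by (intro exI[of _ "\<lambda>x. \<phi>' (f x) * f' x"]) (auto intro: Ck_mult)
qed

lemma Ck_inverse:
  assumes "Ck m S f" "\<And>x. x \<in> S \<Longrightarrow> f x \<noteq> 0"
  shows "Ck m S (\<lambda>x. inverse (f x))"
  using assms
proof (induction m)
  case (Suc m)
  have "Ck m S (\<lambda>x. (-1) * (inverse (f x) * inverse (f x)))"
    using Suc.IH[OF Suc.prems(1)[THEN Ck_SucD] Suc.prems(2)] by (intro Ck_mult Ck_const)
  moreover have "(inverse has_real_derivative (-1) * (inverse (f x) * inverse (f x))) (at (f x))"
    if "x \<in> S" for x
    using DERIV_inverse[of "f x" UNIV] Suc.prems(2)[OF that] by (simp add: power2_eq_square)
  ultimately show ?case
    by (intro Ck_Suc_comp[OF Suc.prems(1), where \<phi>' = "\<lambda>y. (-1) * (inverse y * inverse y)"]) auto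
qed (auto intro: continuous_on_inverse)

lemma Ck_root:
  assumes "odd k" "Ck m S f" "\<And>x. x \<in> S \<Longrightarrow> f x \<noteq> 0"
  shows "Ck m S (\<lambda>x. root k (f x))"
  using assms
proof (induction m)
  case 0
  then show ?case by (auto intro: continuous_on_real_root)
next
  case (Suc m)
  have "k > 0" using Suc.prems(1) by (rule odd_pos)
  then have "Ck m S (\<lambda>x. inverse (real k * root k (f x) ^ (k - Suc 0)))"
    using Suc.IH[OF Suc.prems(1) Suc.prems(2)[THEN Ck_SucD] Suc.prems(3)] Suc.prems(3)
    by (intro Ck_inverse Ck_mult Ck_power Ck_const) auto
  then show ?case
    using DERIV_odd_real_root[OF Suc.prems(1)] Suc.prems(3)
    by (intro Ck_Suc_comp[OF Suc.prems(2), where \<phi>' = "\<lambda>y. inverse (real k * root k y ^ (k - Suc 0))"]) auto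
qed

text \<open>The factor \<open>inverse t ^ n\<close> makes this family closed under differentiation.\<close>

definition flat_exp :: "nat \<Rightarrow> real \<Rightarrow> real" where
  "flat_exp n t = (if t > 0 then exp (- inverse t) * inverse t ^ n else 0)"

lemma flat_exp_nonneg: "flat_exp n t \<ge> 0"
  by (simp add: flat_exp_def)

lemma flat_exp_tendsto_0: "(flat_exp n \<longlongrightarrow> 0) (at 0)"
proof -
  have "((\<lambda>t. inverse t ^ n / exp (inverse t)) \<longlongrightarrow> (0::real)) (at_right 0)"
    by (rule filterlim_compose[OF tendsto_power_div_exp_0 filterlim_inverse_at_top_right])
  moreover have "\<forall>\<^sub>F t in at_right 0. inverse t ^ n / exp (inverse t) = flat_exp n t"
    using eventually_at_right_less[of "0::real"]
    by (rule eventually_mono) (simp add: flat_exp_def exp_minus divide_inverse mult.commute)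
  ultimately have "(flat_exp n \<longlongrightarrow> 0) (at_right 0)"
    by (rule Lim_transform_eventually)
  moreover have "(flat_exp n \<longlongrightarrow> 0) (at_left 0)"
    by (rule tendsto_eventually) (auto simp: flat_exp_def eventually_at_filter)
  ultimately show ?thesis using filterlim_split_at by blast
qed

lemma DERIV_flat_exp:
  "(flat_exp n has_real_derivative flat_exp (n + 2) t - real n * flat_exp (n + 1) t) (at t)"
proof -
  consider "t > 0" | "t < 0" | "t = 0" by linarith
  then show ?thesis
  proof cases
    case 1
    let ?s = "inverse t"
    have "((\<lambda>s. exp (- s) * s ^ n) has_real_derivative exp (- ?s) * (real n * ?s ^ (n - 1)) - exp (- ?s) * ?s ^ n) (at ?s)"
      by (auto intro!: derivative_eq_intros)
    moreover have "(inverse has_real_derivative - (?s\<^sup>2)) (at t)"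
      using DERIV_inverse[of t UNIV] 1 by (simp add: power2_eq_square)
    ultimately have "((\<lambda>t. exp (- inverse t) * inverse t ^ n) has_real_derivative
        (exp (- ?s) * (real n * ?s ^ (n - 1)) - exp (- ?s) * ?s ^ n) * (- (?s\<^sup>2))) (at t)"
      by (rule DERIV_chain2)
    also have "(exp (- ?s) * (real n * ?s ^ (n - 1)) - exp (- ?s) * ?s ^ n) * (- (?s\<^sup>2)) =
        flat_exp (n + 2) t - real n * flat_exp (n + 1) t"
      using 1 by (cases n) (simp_all add: flat_exp_def power2_eq_square right_diff_distrib left_diff_distrib mult_ac)
    finally have "((\<lambda>t. exp (- inverse t) * inverse t ^ n) has_real_derivative
        flat_exp (n + 2) t - real n * flat_exp (n + 1) t) (at t)" .
    moreover have "\<forall>\<^sub>F t in nhds t. flat_exp n t = exp (- inverse t) * inverse t ^ n"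
      using 1 eventually_nhds_in_open[of "{0<..}" t] by (auto elim!: eventually_mono simp: flat_exp_def)
    ultimately show ?thesis by (subst DERIV_cong_ev[OF refl _ refl]) auto
  next
    case 2
    have "\<forall>\<^sub>F t in nhds t. flat_exp n t = 0"
      using 2 eventually_nhds_in_open[of "{..<0}" t] by (auto elim!: eventually_mono simp: flat_exp_def)
    then show ?thesis using 2 by (subst DERIV_cong_ev[OF refl _ refl]) (auto simp: flat_exp_def)
  next
    case 3
    \<comment> \<open>At 0 the difference quotient of \<open>flat_exp n\<close> is again a member of
      the family, so \<open>flat_exp_tendsto_0\<close> yields the derivative.\<close>
    have "(flat_exp n (0 + h) - flat_exp n 0) / h = flat_exp (n + 1) h" for h
      by (simp add: flat_exp_def divide_inverse)
    then have "(flat_exp n has_real_derivative 0) (at 0)"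
      using flat_exp_tendsto_0[of "n + 1"] by (simp add: DERIV_def)
    then show ?thesis using 3 by (simp add: flat_exp_def)
  qed
qed

lemma isCont_flat_exp: "isCont (flat_exp n) t"
  by (rule DERIV_isCont[OF DERIV_flat_exp])

lemma Ck_flat_exp: "Ck m S f \<Longrightarrow> Ck m S (\<lambda>x. flat_exp n (f x))"
proof (induction m arbitrary: n)
  case 0
  then show ?case
    using continuous_on_compose2[of UNIV "flat_exp n" S f]
    by (auto intro: continuous_at_imp_continuous_on isCont_flat_exp)
next
  case (Suc m)
  have "Ck m S (\<lambda>x. flat_exp (n + 2) (f x) + (- real n) * flat_exp (n + 1) (f x))"
    by (intro Ck_add Ck_mult Ck_const Suc.IH Suc.prems[THEN Ck_SucD])
  then show ?case
    using DERIV_flat_exp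
    by (intro Ck_Suc_comp[OF Suc.prems, where \<phi>' = "\<lambda>y. flat_exp (n + 2) y + (- real n) * flat_exp (n + 1) y"]) auto
qed

section \<open>Recovering a matrix from its minors\<close>

text \<open>Arbitrary vectors cover both the minors in \<open>ext_pow\<close> (basis vectors) and
  the enlarged determinants used later. The size is a number, as the passage from \<open>k\<close>
  to \<open>Suc k\<close> by \<open>adj_mat\<close> requires.\<close>

definition form_mat :: "nat \<Rightarrow> real^'n^'m \<Rightarrow> (nat \<Rightarrow> real^'m) \<Rightarrow> (nat \<Rightarrow> real^'n) \<Rightarrow> real mat" where
  "form_mat k A U V = mat k k (\<lambda>(i, j). U i \<bullet> (A *v V j))"

lemma form_mat_carrier [simp]: "form_mat k A U V \<in> carrier_mat k k"
  by (simp add: form_mat_def)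

lemma form_mat_index [simp]: "i < k \<Longrightarrow> j < k \<Longrightarrow> form_mat k A U V $$ (i, j) = U i \<bullet> (A *v V j)"
  by (simp add: form_mat_def)

lemma det_form_mat:
  "Determinant.det (form_mat k A U V) =
     (\<Sum>p | p permutes {0..<k}. of_int (sign p) * (\<Prod>j<k. U (p j) \<bullet> (A *v V j)))"
proof -
  have "(\<Prod>j<k. form_mat k A U V $$ (p j, j)) = (\<Prod>j<k. U (p j) \<bullet> (A *v V j))"
    if "p permutes {0..<k}" for p
    using permutes_in_image[OF that] by (intro prod.cong) auto
  then show ?thesis
    by (subst det_col[OF form_mat_carrier]) (auto intro!: sum.cong)
qed

text \<open>Transfers every statement about the rows \<open>U\<close> to the columns
  \<open>V\<close>.\<close>

lemma det_form_mat_transpose: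
  "Determinant.det (form_mat k A U V) = Determinant.det (form_mat k (Finite_Cartesian_Product.transpose A) V U)"
proof -
  have "form_mat k (Finite_Cartesian_Product.transpose A) V U = transpose_mat (form_mat k A U V)"
    by (rule eq_matI) (auto simp: form_mat_def dot_lmul_matrix[symmetric] inner_commute)
  then show ?thesis using det_transpose[OF form_mat_carrier, of k A U V] by simp
qed

lemma axis_form: "axis a (1::real) \<bullet> (A *v axis b 1) = A $ a $ b"
  by (simp add: inner_axis' matrix_vector_mult_basis column_def)

lemma ext_pow_eq_det:
  assumes "card I = k" "card J = k"
  shows "ext_pow k A $ I $ J = Determinant.det (form_mat k A
    (\<lambda>i. axis (sorted_list_of_set I ! i) 1) (\<lambda>j. axis (sorted_list_of_set J ! j) 1))"
  using assms by (simp add: ext_pow_def det_form_mat axis_form atLeast0LessThan)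

section \<open>Determinants in arbitrary vectors as combinations of minors\<close>

lemma bij_betw_reindex_permutes:
  assumes f: "bij_betw f A S" and g: "bij_betw g A S"
  obtains \<sigma> where "\<sigma> permutes A" "\<And>i. i \<in> A \<Longrightarrow> f i = g (\<sigma> i)"
proof
  let ?\<sigma> = "\<lambda>i. if i \<in> A then inv_into A g (f i) else i"
  have "bij_betw (inv_into A g \<circ> f) A A"
    using f bij_betw_inv_into[OF g] by (rule bij_betw_trans)
  then have "bij_betw ?\<sigma> A A"
    by (rule bij_betw_cong[THEN iffD1, rotated]) simp
  then show "?\<sigma> permutes A" by (rule bij_imp_permutes) simp
  show "f i = g (?\<sigma> i)" if "i \<in> A" for i
    using that f g by (simp add: bij_betw_def f_inv_into_f) (metis f_inv_into_f imageI)
qed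

text \<open>Sorting the indices costs a sign; a repeated index gives two equal rows. The factor
  \<open>e\<close> and the set \<open>I\<close> do not depend on \<open>A\<close>, so they stay
  constant when \<open>A = H x\<close> varies with \<open>x\<close>.\<close>

lemma det_form_mat_rows:
  fixes r :: "nat \<Rightarrow> 'n::{finite,linorder}"
  obtains e I where "card I = k" "\<And>A V. Determinant.det (form_mat k A (\<lambda>i. axis (r i) 1) V) =
    e * Determinant.det (form_mat k A (\<lambda>i. axis (sorted_list_of_set I ! i) 1) V)"
  | "\<And>A V. Determinant.det (form_mat k A (\<lambda>i. axis (r i) 1) V) = 0"
proof (cases "inj_on r {0..<k}")
  case True
  define I where "I = r ` {0..<k}"
  have I: "card I = k" unfolding I_def using card_image[OF True] by simp
  have "bij_betw r {0..<k} I" using True by (simp add: I_def bij_betw_def)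
  moreover have "bij_betw (\<lambda>i. sorted_list_of_set I ! i) {0..<k} I"
    using I by (intro bij_betw_nth) (auto simp: I_def atLeast0LessThan)
  ultimately obtain \<sigma> where \<sigma>: "\<sigma> permutes {0..<k}"
    "\<And>i. i \<in> {0..<k} \<Longrightarrow> r i = sorted_list_of_set I ! \<sigma> i"
    using bij_betw_reindex_permutes by blast
  have "Determinant.det (form_mat k A (\<lambda>i. axis (r i) 1) V) =
    of_int (sign \<sigma>) * Determinant.det (form_mat k A (\<lambda>i. axis (sorted_list_of_set I ! i) 1) V)" for A V
  proof -
    let ?B = "form_mat k A (\<lambda>i. axis (sorted_list_of_set I ! i) 1) V"
    have "form_mat k A (\<lambda>i. axis (r i) 1) V = mat k k (\<lambda>(i, j). ?B $$ (\<sigma> i, j))"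
      using \<sigma>(2) permutes_in_image[OF \<sigma>(1)] by (intro eq_matI) (auto simp: form_mat_def)
    then show ?thesis using det_permute_rows[OF form_mat_carrier \<sigma>(1)] by simp
  qed
  then show thesis using that(1) I by blast
next
  case False
  then obtain i j where "i < k" "j < k" "i \<noteq> j" "r i = r j"
    by (auto simp: inj_on_def)
  then have "Determinant.det (form_mat k A (\<lambda>i. axis (r i) 1) V) = 0" for A V
    by (intro det_identical_rows[OF form_mat_carrier, of i j]) (auto simp: form_mat_def)
  then show thesis by (rule that(2))
qed

lemma Ck_det_axis:
  fixes H :: "real^'l::finite \<Rightarrow> real^('n::{finite,linorder})^('n::{finite,linorder})"
  assumes "\<And>I J. Ck m S (\<lambda>x. ext_pow k (H x) $ I $ J)"
  shows "Ck m S (\<lambda>x. Determinant.det (form_mat k (H x) (\<lambda>i. axis (r i) 1) (\<lambda>j. axis (c j) 1)))"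
proof (rule det_form_mat_rows[of k r])
  fix e I
  assume I: "card I = k" and e: "\<And>A V. Determinant.det (form_mat k A (\<lambda>i. axis (r i) 1) V) =
    e * Determinant.det (form_mat k (A::real^('n::{finite,linorder})^('n::{finite,linorder})) (\<lambda>i. axis (sorted_list_of_set I ! i) 1) V)"
  show ?thesis
  proof (rule det_form_mat_rows[of k c])
    fix d J
    assume J: "card J = k" and d: "\<And>A V. Determinant.det (form_mat k A (\<lambda>i. axis (c i) 1) V) =
      d * Determinant.det (form_mat k (A::real^('n::{finite,linorder})^('n::{finite,linorder})) (\<lambda>i. axis (sorted_list_of_set J ! i) 1) V)"
    have "Determinant.det (form_mat k (H x) (\<lambda>i. axis (r i) 1) (\<lambda>j. axis (c j) 1)) =
        e * (d * ext_pow k (H x) $ I $ J)" for x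
      unfolding e ext_pow_eq_det[OF I J]
      unfolding det_form_mat_transpose[of k "H x" "\<lambda>i. axis (sorted_list_of_set I ! i) 1"] d ..
    then show ?thesis using assms by (simp add: Ck_mult Ck_const)
  next
    assume "\<And>A V. Determinant.det (form_mat k (A::real^('n::{finite,linorder})^('n::{finite,linorder})) (\<lambda>i. axis (c i) 1) V) = 0"
    then show ?thesis by (simp add: det_form_mat_transpose[of k "H _"] Ck_const)
  qed
next
  assume "\<And>A V. Determinant.det (form_mat k (A::real^('n::{finite,linorder})^('n::{finite,linorder})) (\<lambda>i. axis (r i) 1) V) = 0"
  then show ?thesis by (simp add: Ck_const)
qed

text \<open>Multilinearity in the columns. The sum runs over all index maps \<open>c\<close>,
  injective or not, which \<open>Ck_det_axis\<close> admits.\<close>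

lemma det_form_mat_expand:
  fixes A :: "real^'n^'m"
  shows "Determinant.det (form_mat k A U V) =
    (\<Sum>c\<in>Pi\<^sub>E {..<k} (\<lambda>_. UNIV). (\<Prod>j<k. V j $ c j) *
      Determinant.det (form_mat k A U (\<lambda>j. axis (c j) 1)))"
proof -
  have form_sum: "u \<bullet> (A *v v) = (\<Sum>b\<in>UNIV. v $ b * (u \<bullet> (A *v axis b 1)))" for u v
  proof -
    have "A *v v = (\<Sum>b\<in>UNIV. v $ b *\<^sub>R (A *v axis b 1))"
      by (simp only: matrix_vector_mult_basis matrix_mult_sum[of A v] scalar_mult_eq_scaleR)
    then show ?thesis by (simp add: inner_sum_right)
  qed
  have "(\<Prod>j<k. U (p j) \<bullet> (A *v V j)) = (\<Sum>c\<in>Pi\<^sub>E {..<k} (\<lambda>_. UNIV).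
      (\<Prod>j<k. V j $ c j) * (\<Prod>j<k. U (p j) \<bullet> (A *v axis (c j) 1)))" for p
    unfolding form_sum[of "U (p j)" "V j" for j] by (simp add: prod_sum_PiE prod.distrib)
  then have "Determinant.det (form_mat k A U V) = (\<Sum>p | p permutes {0..<k}. \<Sum>c\<in>Pi\<^sub>E {..<k} (\<lambda>_. UNIV).
      (\<Prod>j<k. V j $ c j) * (of_int (sign p) * (\<Prod>j<k. U (p j) \<bullet> (A *v axis (c j) 1))))"
    unfolding det_form_mat by (simp add: sum_distrib_left mult.left_commute)
  then show ?thesis
    by (subst (asm) sum.swap) (simp only: det_form_mat sum_distrib_left)
qed

text \<open>The determinant pairs the exterior power of \<open>H x\<close> with two fixed
  decomposable \<open>k\<close>-vectors, so it is a combination of its entries with constant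
  coefficients.\<close>

lemma Ck_det_form_mat:
  fixes H :: "real^'l::finite \<Rightarrow> real^('n::{finite,linorder})^('n::{finite,linorder})"
  assumes "\<And>I J. Ck m S (\<lambda>x. ext_pow k (H x) $ I $ J)"
  shows "Ck m S (\<lambda>x. Determinant.det (form_mat k (H x) U V))"
proof -
  have "Determinant.det (form_mat k (H x) U (\<lambda>j. axis (c j) 1)) =
      (\<Sum>r\<in>Pi\<^sub>E {..<k} (\<lambda>_. UNIV). (\<Prod>i<k. U i $ r i) *
        Determinant.det (form_mat k (H x) (\<lambda>i. axis (r i) 1) (\<lambda>j. axis (c j) 1)))" for x c
    unfolding det_form_mat_transpose[of k "H x"] by (rule det_form_mat_expand)
  then have "Ck m S (\<lambda>x. Determinant.det (form_mat k (H x) U (\<lambda>j. axis (c j) 1)))" for c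
    by (simp only:) (intro Ck_sum Ck_mult Ck_const Ck_det_axis assms)
  then show ?thesis
    by (subst det_form_mat_expand) (intro Ck_sum Ck_mult Ck_const)
qed

section \<open>Rank of an exterior power\<close>

lemma rank_factorization:
  fixes A :: "real^'n^'m"
  assumes "rank A \<le> k"
  obtains P Q where "\<And>a b. A $ a $ b = (\<Sum>l<k. P l a * Q l b)"
proof -
  obtain B where B: "B \<subseteq> columns A" "independent B" "columns A \<subseteq> span B" "card B = rank A"
    using basis_exists[of "columns A"] by (metis column_rank_def)
  have "finite B" using B(2) by (rule independent_imp_finite)
  then obtain h where h: "bij_betw h {0..<rank A} B"
    using ex_bij_betw_nat_finite[of B] B(4) by metis
  have "\<exists>u. column b A = (\<Sum>v\<in>B. u v *\<^sub>R v)" for b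
  proof -
    have "column b A \<in> span B" using B(3) by (auto simp: columns_def)
    then show ?thesis using span_finite[OF \<open>finite B\<close>] by auto
  qed
  then obtain u where u: "\<And>b. column b A = (\<Sum>v\<in>B. u b v *\<^sub>R v)" by metis
  show thesis
  proof (rule that)
    fix a b
    have "A $ a $ b = column b A $ a" by (simp add: column_def)
    also have "\<dots> = (\<Sum>v\<in>B. v $ a * u b v)" by (simp add: u mult.commute)
    also have "\<dots> = (\<Sum>l\<in>{0..<rank A}. h l $ a * u b (h l))"
      using h by (rule sum.reindex_bij_betw[symmetric])
    \<comment> \<open>Padding with zeros gives exactly \<open>k\<close> terms, whatever the
      rank.\<close>
    also have "\<dots> = (\<Sum>l<k. (if l < rank A then h l $ a else 0) * u b (h l))"
      using assms by (intro sum.mono_neutral_cong_left) auto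
    finally show "A $ a $ b = (\<Sum>l<k. (if l < rank A then h l $ a else 0) * u b (h l))" .
  qed
qed

text \<open>\<open>A\<close> is a product of two factors with inner dimension \<open>k\<close>, so
  each minor is a product of two determinants of size \<open>k\<close>, one depending on
  \<open>I\<close> alone and one on \<open>J\<close> alone. All columns are therefore multiples of
  one vector.\<close>

lemma rank_ext_pow_le_1:
  fixes A :: "real^('n::{finite,linorder})^('n::{finite,linorder})"
  assumes "rank A \<le> k"
  shows "rank (ext_pow k A) \<le> 1"
proof -
  obtain P Q where PQ: "\<And>a b. A $ a $ b = (\<Sum>l<k. P l a * Q l b)"
    using rank_factorization[OF assms] by metis
  define \<alpha> where "\<alpha> I = (if card I = k then Determinant.det (mat k k (\<lambda>(i, l). P l (sorted_list_of_set I ! i))) else 0)" for I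
  define \<beta> where "\<beta> J = (if card J = k then Determinant.det (mat k k (\<lambda>(l, j). Q l (sorted_list_of_set J ! j))) else 0)" for J
  have "ext_pow k A $ I $ J = \<beta> J * \<alpha> I" for I J
  proof (cases "card I = k \<and> card J = k")
    case True
    have "form_mat k A (\<lambda>i. axis (sorted_list_of_set I ! i) 1) (\<lambda>j. axis (sorted_list_of_set J ! j) 1)
      = mat k k (\<lambda>(i, l). P l (sorted_list_of_set I ! i)) * mat k k (\<lambda>(l, j). Q l (sorted_list_of_set J ! j))"
      by (rule eq_matI) (auto simp: form_mat_def axis_form PQ scalar_prod_def atLeast0LessThan)
    then show ?thesis
      using True det_mult[of "mat k k (\<lambda>(i, l). P l (sorted_list_of_set I ! i))" k
        "mat k k (\<lambda>(l, j). Q l (sorted_list_of_set J ! j))"]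
      by (simp add: ext_pow_eq_det \<alpha>_def \<beta>_def)
  qed (auto simp: ext_pow_def \<alpha>_def \<beta>_def)
  then have "column J (ext_pow k A) = \<beta> J *\<^sub>R (\<chi> I. \<alpha> I)" for J
    by (simp add: column_def Finite_Cartesian_Product.vec_eq_iff)
  then have "columns (ext_pow k A) \<subseteq> span {\<chi> I. \<alpha> I}"
    by (auto simp: columns_def intro!: span_mul[OF span_base])
  then have "dim (columns (ext_pow k A)) \<le> card {\<chi> I. \<alpha> I}"
    by (rule dim_le_card) simp
  then show ?thesis by (simp add: column_rank_def)
qed

lemma rank_ext_pow_gt:
  fixes A :: "real^('n::{finite,linorder})^('n::{finite,linorder})"
  assumes "rank (ext_pow k A) > k" "k \<ge> 1"
  shows "rank A > k"
  using rank_ext_pow_le_1[of A k] assms by linarith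

section \<open>Adjugates\<close>

lemma Ck_det:
  assumes "\<And>x. B x \<in> carrier_mat n n" "\<And>i j. i < n \<Longrightarrow> j < n \<Longrightarrow> Ck m S (\<lambda>x. B x $$ (i, j))"
  shows "Ck m S (\<lambda>x. Determinant.det (B x))"
proof -
  have "p i < n" if "p permutes {0..<n}" "i < n" for p i
    using permutes_in_image[OF that(1)] that(2) by auto
  then show ?thesis
    unfolding det_def'[OF assms(1)] by (intro Ck_sum Ck_mult Ck_const Ck_prod assms(2)) auto
qed

lemma Ck_adj_mat:
  assumes "\<And>x. B x \<in> carrier_mat n n" "\<And>i j. i < n \<Longrightarrow> j < n \<Longrightarrow> Ck m S (\<lambda>x. B x $$ (i, j))"
    and "i < n" "j < n"
  shows "Ck m S (\<lambda>x. adj_mat (B x) $$ (i, j))"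
proof -
  have dim: "dim_row (B x) = n" "dim_col (B x) = n" for x using assms(1)[of x] by auto
  have "Ck m S (\<lambda>x. Determinant.det (mat_delete (B x) j i))"
  proof (rule Ck_det)
    show "mat_delete (B x) j i \<in> carrier_mat (n - 1) (n - 1)" for x
      by (rule mat_delete_carrier[OF assms(1)])
    show "Ck m S (\<lambda>x. mat_delete (B x) j i $$ (i', j'))" if "i' < n - 1" "j' < n - 1" for i' j'
      using that by (simp add: mat_delete_def dim assms(2))
  qed
  then show ?thesis
    using assms(3,4) by (simp add: adj_mat_def dim cofactor_def Ck_mult Ck_const)
qed

text \<open>Deleting a row and a column drops one vector from \<open>U\<close> and one from
  \<open>V\<close>. The adjugate of a form matrix of size \<open>Suc k\<close> thus consists of
  determinants of size \<open>k\<close>, which \<open>Ck_det_form_mat\<close> controls.\<close>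

lemma adj_mat_form_mat:
  assumes "i < Suc k" "j < Suc k"
  shows "adj_mat (form_mat (Suc k) A U V) $$ (i, j) =
    (-1) ^ (j + i) * Determinant.det (form_mat k A (U \<circ> insert_index j) (V \<circ> insert_index i))"
proof -
  have "mat_delete (form_mat (Suc k) A U V) j i = form_mat k A (U \<circ> insert_index j) (V \<circ> insert_index i)"
    by (rule eq_matI) (auto simp: mat_delete_def form_mat_def insert_index_def)
  then show ?thesis using assms by (simp add: adj_mat_def cofactor_def form_mat_def)
qed

lemma det_adj_mat:
  fixes M :: "real mat"
  assumes M: "M \<in> carrier_mat (Suc k) (Suc k)" and k: "k \<ge> 1"
  shows "Determinant.det (adj_mat M) = Determinant.det M ^ k"
proof (cases "Determinant.det M = 0")
  case False
  \<comment> \<open>Since \<open>M * adj_mat M\<close> is \<open>det M\<close> times the identity,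
    its determinant is \<open>det M ^ Suc k\<close>; one factor cancels.\<close>
  have "Determinant.det M * Determinant.det (adj_mat M) = Determinant.det M * Determinant.det M ^ k"
    unfolding det_mult[OF M adj_mat(1)[OF M], symmetric] adj_mat(2)[OF M] by simp
  then show ?thesis using False by (metis mult_cancel_left)
next
  case True
  let ?N = "adj_mat M"
  have N: "?N \<in> carrier_mat (Suc k) (Suc k)" by (rule adj_mat(1)[OF M])
  have "Determinant.det ?N = 0"
  proof (rule ccontr)
    \<comment> \<open>If \<open>?N\<close> were invertible, \<open>M * ?N = 0\<close> would force
      \<open>M = 0\<close>; then all cofactors of \<open>M\<close>, and with them \<open>?N\<close>,
      would vanish. Multiplication by \<open>adj_mat ?N\<close> plays the role of the
      inverse.\<close>
    assume d: "Determinant.det ?N \<noteq> 0"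
    have "M * ?N = 0\<^sub>m (Suc k) (Suc k)"
      unfolding adj_mat(2)[OF M] True by (rule eq_matI) auto
    then have "M * ?N * adj_mat ?N = 0\<^sub>m (Suc k) (Suc k)"
      using left_mult_zero_mat[OF adj_mat(1)[OF N]] by simp
    then have "Determinant.det ?N \<cdot>\<^sub>m M = 0\<^sub>m (Suc k) (Suc k)"
      using assoc_mult_mat[OF M N adj_mat(1)[OF N]] adj_mat(2)[OF N] M
        mult_smult_distrib[OF M one_carrier_mat] by simp
    then have M0: "M $$ (i, j) = 0" if "i < Suc k" "j < Suc k" for i j
      using d that M by (auto dest!: arg_cong[where f = "\<lambda>B. B $$ (i, j)"])
    have "?N $$ (i, j) = 0" if "i < Suc k" "j < Suc k" for i j
    proof -
      have "mat_delete M j i = 0\<^sub>m k k"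
        using M0 M by (intro eq_matI) (auto simp: mat_delete_def)
      then show ?thesis using that M k by (simp add: adj_mat_def cofactor_def)
    qed
    then have "?N = 0\<^sub>m (Suc k) (Suc k)" using N by (intro eq_matI) auto
    then show False using d det_zero[of "Suc k"] by simp
  qed
  then show ?thesis using True k by simp
qed

text \<open>The two bracketings of \<open>M * adj_mat M * adj_mat (adj_mat M)\<close>. The identity
  is free of division; it is divided by \<open>det (adj_mat M)\<close> only where that is
  nonzero.\<close>

lemma adj_mat_adj_mat:
  fixes M :: "real mat"
  assumes M: "M \<in> carrier_mat n n" and "i < n" "j < n"
  shows "Determinant.det M * adj_mat (adj_mat M) $$ (i, j) = Determinant.det (adj_mat M) * M $$ (i, j)"
proof -
  let ?N = "adj_mat M"
  have N: "?N \<in> carrier_mat n n" by (rule adj_mat(1)[OF M])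
  have "M * ?N * adj_mat ?N = M * (?N * adj_mat ?N)"
    by (rule assoc_mult_mat[OF M N adj_mat(1)[OF N]])
  then have "Determinant.det M \<cdot>\<^sub>m adj_mat ?N = Determinant.det ?N \<cdot>\<^sub>m M"
    using adj_mat(2)[OF M] adj_mat(2)[OF N] M adj_mat(1)[OF N]
      mult_smult_distrib[OF M one_carrier_mat] mult_smult_assoc_mat[OF one_carrier_mat adj_mat(1)[OF N]]
    by simp
  then show ?thesis
    using assms adj_mat(1)[OF N] by (auto dest!: arg_cong[where f = "\<lambda>B. B $$ (i, j)"])
qed

text \<open>The rows and columns are completed so that the matrix of the form becomes upper triangular
  with diagonal \<open>u \<bullet> (A *v v), 1, \<dots>, 1\<close>.\<close>

lemma nonsingular_completion:
  fixes A :: "real^'n^'m"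
  assumes rank: "rank A > k" and uv: "u \<bullet> (A *v v) \<noteq> 0"
  obtains U V where "U 0 = u" "V 0 = v" "Determinant.det (form_mat (Suc k) A U V) \<noteq> 0"
proof -
  let ?R = "range (\<lambda>x. A *v x)"
  let ?w = "A *v v"
  have "?w \<noteq> 0" using uv by auto
  then have "{?w} \<subseteq> ?R" "independent {?w}" by (auto simp: dependent_single)
  then obtain B where B: "{?w} \<subseteq> B" "B \<subseteq> ?R" "independent B" "?R \<subseteq> span B"
    using maximal_independent_subset_extend by blast
  have "card B = rank A"
    using basis_card_eq_dim[OF B(2,4,3)] by (simp add: rank_dim_range)
  moreover have "finite B" using B(3) by (rule independent_imp_finite)
  \<comment> \<open>\<open>B\<close> is a basis of the range that contains \<open>A *v v\<close>;
    since \<open>rank A > k\<close>, it has at least \<open>k\<close> further elements.\<close>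
  ultimately have "k \<le> card (B - {?w})" using rank B(1) by simp
  then obtain C where C: "C \<subseteq> B - {?w}" "card C = k" "finite C"
    by (rule obtain_subset_with_card_n)
  then obtain h where h: "bij_betw h {1..k} C"
    using ex_bij_betw_nat_finite_1[of C] by auto
  define W where "W j = (if j = 0 then ?w else h j)" for j
  have hC: "h j \<in> C" if "1 \<le> j" "j \<le> k" for j
    using h that by (auto simp: bij_betw_def)
  have WB: "W j \<in> B" if "j \<le> k" for j
    using B(1) C(1) hC[of j] that by (cases "j = 0") (auto simp: W_def)
  have W_inj: "W i = W j \<longleftrightarrow> i = j" if "i \<le> k" "j \<le> k" for i j
  proof -
    have "h i = h j \<longleftrightarrow> i = j" if "1 \<le> i" "1 \<le> j"
      using h that \<open>i \<le> k\<close> \<open>j \<le> k\<close> by (intro inj_on_eq_iff[of h "{1..k}"]) (auto simp: bij_betw_def)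
    moreover have "?w \<noteq> h i" if "1 \<le> i" using C(1) hC[OF that \<open>i \<le> k\<close>] by auto
    moreover have "?w \<noteq> h j" if "1 \<le> j" using C(1) hC[OF that \<open>j \<le> k\<close>] by auto
    ultimately show ?thesis unfolding W_def by (cases "i = 0"; cases "j = 0") auto
  qed
  have "\<forall>j. \<exists>y. j \<le> k \<longrightarrow> A *v y = W j \<and> (j = 0 \<longrightarrow> y = v)"
  proof
    fix j
    show "\<exists>y. j \<le> k \<longrightarrow> A *v y = W j \<and> (j = 0 \<longrightarrow> y = v)"
    proof (cases "j = 0 \<or> \<not> j \<le> k")
      case False
      then have "W j \<in> ?R" using B(2) WB[of j] by blast
      then show ?thesis using False by auto
    qed (auto simp: W_def)
  qed
  from choice[OF this] obtain V where V: "\<And>j. j \<le> k \<Longrightarrow> A *v V j = W j" "V 0 = v" by blast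
  \<comment> \<open>Vectors dual to \<open>W 0\<close> up to \<open>W k\<close>: the functional that
    is 1 at \<open>W i\<close> and 0 at the other elements of \<open>B\<close> is represented by
    \<open>adjoint g 1\<close>. For \<open>i > k\<close> the zero vector serves.\<close>
  have "\<forall>i. \<exists>y. \<forall>j\<le>k. y \<bullet> W j = (if j = i then 1 else (0::real))"
  proof
    fix i
    show "\<exists>y. \<forall>j\<le>k. y \<bullet> W j = (if j = i then 1 else (0::real))"
    proof (cases "i \<le> k")
      case True
      obtain g where g: "linear g" "\<forall>b\<in>B. g b = (if b = W i then 1 else (0::real))"
        using linear_independent_extend[OF B(3), of "\<lambda>b. if b = W i then 1 else (0::real)"] by blast
      have "adjoint g 1 \<bullet> W j = (if j = i then 1 else 0)" if "j \<le> k" for j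
      proof -
        have "adjoint g 1 \<bullet> W j = g (W j) \<bullet> 1"
          using adjoint_works[OF g(1), of "W j" 1] by (simp only: inner_commute)
        also have "\<dots> = (if W j = W i then 1 else 0)" using g(2) WB[OF that] by simp
        finally show ?thesis by (simp only: W_inj[OF that True])
      qed
      then show ?thesis by blast
    next
      case False
      then have "\<forall>j\<le>k. 0 \<bullet> W j = (if j = i then 1 else (0::real))" by simp
      then show ?thesis ..
    qed
  qed
  from choice[OF this] obtain Y where
    Y: "\<And>i j. j \<le> k \<Longrightarrow> Y i \<bullet> W j = (if j = i then 1 else (0::real))" by blast
  \<comment> \<open>Only row 0 deviates from the dual vectors, so the matrix differs from the
    identity in that row alone.\<close>
  define U where "U i = (if i = 0 then u else Y i)" for i
  let ?M = "form_mat (Suc k) A U V"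
  have M: "?M $$ (i, j) = (if j = i then 1 else 0)" if "1 \<le> i" "i \<le> k" "j \<le> k" for i j
    using that by (simp add: V U_def Y)
  have "upper_triangular ?M"
    using M by (auto simp: upper_triangular_def form_mat_def)
  then have "Determinant.det ?M = prod_list (diag_mat ?M)"
    by (rule det_upper_triangular[OF _ form_mat_carrier])
  also have "\<dots> = (\<Prod>i\<in>{0..<Suc k}. ?M $$ (i, i))"
    using carrier_matD[OF form_mat_carrier, of "Suc k" A U V] by (simp add: prod_list_diag_prod)
  also have "\<dots> = u \<bullet> ?w * (\<Prod>i\<in>{1..<Suc k}. ?M $$ (i, i))"
    by (subst prod.atLeast_Suc_lessThan) (auto simp: U_def V)
  also have "(\<Prod>i\<in>{1..<Suc k}. ?M $$ (i, i)) = 1"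
    using M by (intro prod.neutral) auto
  finally have "Determinant.det ?M \<noteq> 0" using uv by simp
  moreover have "U 0 = u" by (simp add: U_def)
  ultimately show thesis using V(2) that by blast
qed

section \<open>Local smoothness of the forms\<close>

text \<open>The neighbourhood is chosen before the order: one open set serves all
  \<open>m\<close>.\<close>

definition locally_smooth :: "(real^'n::finite) \<Rightarrow> (real^'n \<Rightarrow> real) \<Rightarrow> bool" where
  "locally_smooth x g \<longleftrightarrow> (\<exists>T. open T \<and> x \<in> T \<and> (\<forall>m. Ck m T g))"

lemma locally_smooth_add:
  assumes "locally_smooth x f" "locally_smooth x g"
  shows "locally_smooth x (\<lambda>x. f x + g x)"
proof -
  obtain T T' where "open T" "x \<in> T" "\<And>m. Ck m T f" "open T'" "x \<in> T'" "\<And>m. Ck m T' g"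
    using assms unfolding locally_smooth_def by metis
  then show ?thesis unfolding locally_smooth_def
    by (intro exI[of _ "T \<inter> T'"]) (auto intro!: Ck_add intro: Ck_subset)
qed

lemma smooth_real_on_local:
  assumes "\<And>x. x \<in> S \<Longrightarrow> locally_smooth x g"
  shows "smooth_real_on S g"
  unfolding smooth_real_on_def
proof (intro allI conjI ballI)
  have T: "\<exists>T. open T \<and> x \<in> T \<and> smooth_real_on T g" if "x \<in> S" for x
    using assms[OF that] smooth_real_on_iff_Ck unfolding locally_smooth_def by metis
  show "continuous_on S (ipd js g)" for js
  proof (rule continuous_at_imp_continuous_on, rule)
    fix x assume "x \<in> S"
    then show "isCont (ipd js g) x"
      using T unfolding smooth_real_on_def by (metis continuous_on_eq_continuous_at)
  qed
  show "\<exists>D. has_partial (ipd js g) j D x" if "x \<in> S" for js j x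
    using T[OF that] unfolding smooth_real_on_def by metis
qed

lemma locally_smooth_form_nonzero:
  fixes H :: "real^'l::finite \<Rightarrow> real^('n::{finite,linorder})^('n::{finite,linorder})"
  assumes k: "odd k" and S: "open S" "x0 \<in> S"
    and smooth: "\<And>m I J. Ck m S (\<lambda>x. ext_pow k (H x) $ I $ J)"
    and rank: "rank (H x0) > k" and uv: "u \<bullet> (H x0 *v v) \<noteq> 0"
  shows "locally_smooth x0 (\<lambda>x. u \<bullet> (H x *v v))"
proof -
  have k1: "k \<ge> 1" using odd_pos[OF k] by simp
  \<comment> \<open>\<open>U\<close> and \<open>V\<close> are chosen at \<open>x0\<close> and then
    kept; only \<open>H x\<close> varies in \<open>M x\<close>.\<close>
  obtain U V where UV: "U 0 = u" "V 0 = v" "Determinant.det (form_mat (Suc k) (H x0) U V) \<noteq> 0"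
    using nonsingular_completion[OF rank uv] by blast
  define M where "M x = form_mat (Suc k) (H x) U V" for x
  define N where "N x = adj_mat (M x)" for x
  define d where "d x = Determinant.det (N x)" for x
  have M: "M x \<in> carrier_mat (Suc k) (Suc k)" for x by (simp add: M_def)
  have N: "N x \<in> carrier_mat (Suc k) (Suc k)" for x unfolding N_def by (rule adj_mat(1)[OF M])
  have d: "d x = Determinant.det (M x) ^ k" for x
    unfolding d_def N_def by (rule det_adj_mat[OF M k1])
  then have root_d: "root k (d x) = Determinant.det (M x)" for x
    using k by (simp add: odd_real_root_power_cancel)
  have Ck_N: "Ck m S (\<lambda>x. N x $$ (i, j))" if "i < Suc k" "j < Suc k" for m i j
    unfolding N_def M_def adj_mat_form_mat[OF that]
    by (intro Ck_mult Ck_const Ck_det_form_mat smooth)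
  have Ck_d: "Ck m S d" for m
    unfolding d_def using N Ck_N by (rule Ck_det)
  \<comment> \<open>\<open>d\<close> is a power of \<open>det (M x)\<close>, so \<open>T\<close> is
    the part of \<open>S\<close> where \<open>M x\<close> is nonsingular; there
    \<open>root k\<close> and \<open>inverse\<close> are smooth at \<open>d x\<close>.\<close>
  define T where "T = {x \<in> S. d x \<noteq> 0}"
  have "open T"
    using continuous_open_preimage[OF Ck_continuous_on[OF Ck_d] S(1), of "- {0}"]
    by (simp add: T_def vimage_def Int_def open_Compl)
  moreover have "x0 \<in> T"
    using UV(3) S(2) by (simp add: T_def d M_def)
  moreover have "Ck m T (\<lambda>x. u \<bullet> (H x *v v))" for m
  proof -
    have "T \<subseteq> S" by (auto simp: T_def)
    \<comment> \<open>This is the (0, 0) entry of the double adjugate, multiplied by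
      \<open>det (M x)\<close> and divided by \<open>d x\<close>. It equals the form because
      \<open>U 0 = u\<close> and \<open>V 0 = v\<close>.\<close>
    have "Ck m T (\<lambda>x. root k (d x) * adj_mat (N x) $$ (0, 0) * inverse (d x))"
      using \<open>T \<subseteq> S\<close> k
      by (intro Ck_mult Ck_root Ck_inverse Ck_subset[OF Ck_d] Ck_adj_mat[OF N] Ck_subset[OF Ck_N])
        (auto simp: T_def)
    moreover have "root k (d x) * adj_mat (N x) $$ (0, 0) * inverse (d x) = u \<bullet> (H x *v v)" if "x \<in> T" for x
      using adj_mat_adj_mat[OF M, of 0 0 x] that UV(1,2)
    proof -
      have "Determinant.det (M x) * adj_mat (N x) $$ (0, 0) = d x * M x $$ (0, 0)"
        unfolding d_def N_def by (rule adj_mat_adj_mat[OF M]) simp_all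
      moreover have "d x \<noteq> 0" using that by (simp add: T_def)
      moreover have "M x $$ (0, 0) = u \<bullet> (H x *v v)" by (simp add: M_def UV)
      ultimately show ?thesis by (simp add: root_d)
    qed
    ultimately show ?thesis
      by (rule Ck_cong[OF \<open>open T\<close>, THEN iffD1, rotated])
  qed
  ultimately show ?thesis unfolding locally_smooth_def by blast
qed

text \<open>By linearity in \<open>u\<close> and \<open>v\<close>, a form that vanishes at
  \<open>x0\<close> is a combination of forms that do not.\<close>

lemma locally_smooth_form:
  fixes H :: "real^'l::finite \<Rightarrow> real^('n::{finite,linorder})^('n::{finite,linorder})"
  assumes k: "odd k" and S: "open S" "x0 \<in> S"
    and smooth: "\<And>m I J. Ck m S (\<lambda>x. ext_pow k (H x) $ I $ J)"
    and rank: "rank (H x0) > k"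
  shows "locally_smooth x0 (\<lambda>x. u \<bullet> (H x *v v))"
proof -
  note nonzero = locally_smooth_form_nonzero[OF k S smooth rank]
  have step: "locally_smooth x0 (\<lambda>x. u \<bullet> (H x *v v))" if v: "H x0 *v v \<noteq> 0" for u v
  proof (cases "u \<bullet> (H x0 *v v) = 0")
    case True
    let ?w = "H x0 *v v"
    \<comment> \<open>At \<open>x0\<close> the two summands are \<open>?w \<bullet> ?w\<close> and
      its negative, both nonzero.\<close>
    have "locally_smooth x0 (\<lambda>x. ?w \<bullet> (H x *v v) + (u - ?w) \<bullet> (H x *v v))"
      using v True by (intro locally_smooth_add nonzero) (auto simp: inner_diff_left)
    then show ?thesis by (simp add: inner_diff_left)
  qed (rule nonzero)
  show ?thesis
  proof (cases "H x0 *v v = 0")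
    case True
    have "\<exists>w. H x0 *v w \<noteq> 0"
    proof (rule ccontr)
      assume "\<not> ?thesis"
      then have "range (\<lambda>x. H x0 *v x) = {0}" by auto
      then show False using rank by (simp add: rank_dim_range)
    qed
    then obtain w where w: "H x0 *v w \<noteq> 0" by blast
    \<comment> \<open>\<open>H x0\<close> sends \<open>v + w\<close> and \<open>w\<close> to the
      same nonzero vector, so \<open>step\<close> applies to each summand.\<close>
    have "locally_smooth x0 (\<lambda>x. u \<bullet> (H x *v (v + w)) + (- u) \<bullet> (H x *v w))"
      using w True by (intro locally_smooth_add step) (simp_all add: matrix_vector_right_distrib)
    then show ?thesis by (simp add: matrix_vector_right_distrib inner_add_right)
  qed (rule step)
qed

theorem smooth_of_smooth_ext_pow:
  fixes H :: "real^'l::finite \<Rightarrow> real^('n::{finite,linorder})^('n::{finite,linorder})"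
  assumes "odd k" "open S" "smooth_mat_on S (\<lambda>x. ext_pow k (H x))"
    and "\<And>x. x \<in> S \<Longrightarrow> rank (ext_pow k (H x)) > k"
  shows "smooth_mat_on S H"
  unfolding smooth_mat_on_def
proof (intro allI smooth_real_on_local)
  fix i j x assume x: "x \<in> S"
  have "rank (H x) > k"
    using assms(4)[OF x] odd_pos[OF assms(1)] by (intro rank_ext_pow_gt) auto
  moreover have "Ck m S (\<lambda>x. ext_pow k (H x) $ I $ J)" for m I J
    using assms(3) smooth_real_on_iff_Ck[OF assms(2)] unfolding smooth_mat_on_def by blast
  ultimately have "locally_smooth x (\<lambda>x. axis i 1 \<bullet> (H x *v axis j 1))"
    using locally_smooth_form[OF assms(1,2) x] by blast
  then show "locally_smooth x (\<lambda>x. H x $ i $ j)" by (simp add: axis_form)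
qed

section \<open>Functions with continuous weak gradient\<close>

lemma integrable_bounded_support:
  fixes f :: "'a::euclidean_space \<Rightarrow> real"
  assumes "f \<in> borel_measurable borel" "\<And>x. \<bar>f x\<bar> \<le> C" "bounded S" "\<And>x. x \<notin> S \<Longrightarrow> f x = 0"
  shows "integrable lborel f"
proof -
  obtain R where "S \<subseteq> cball 0 R"
    using assms(3) unfolding bounded_iff by (auto simp: subset_iff)
  moreover have "emeasure lborel (cball (0::'a) R) < \<infinity>"
    by (intro emeasure_bounded_finite bounded_cball)
  moreover have "f x = 0" if "x \<notin> cball 0 R" for x
    using that \<open>S \<subseteq> cball 0 R\<close> assms(4) by blast
  ultimately show ?thesis
    using assms(1,2) by (intro integrableI_bounded_set[where A = "cball 0 R" and B = C]) auto
qed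

lemma Fubini_bounded_support:
  fixes f :: "'a::euclidean_space \<Rightarrow> 'b::euclidean_space \<Rightarrow> real"
  assumes "(\<lambda>(x, y). f x y) \<in> borel_measurable borel" "\<And>x y. \<bar>f x y\<bar> \<le> C"
    and "bounded S" "bounded T" "\<And>x y. x \<notin> S \<or> y \<notin> T \<Longrightarrow> f x y = 0"
  shows "(LBINT x. LBINT y. f x y) = (LBINT y. LBINT x. f x y)"
proof -
  have "integrable lborel (\<lambda>(x, y). f x y)"
    using assms by (intro integrable_bounded_support[where S = "S \<times> T" and C = C])
      (auto intro: bounded_Times)
  then show ?thesis
    using lborel_pair.Fubini_integral[of f] by (simp add: lborel_prod)
qed

lemma integral_lborel_translate:
  fixes f :: "'a::euclidean_space \<Rightarrow> real"
  assumes "f \<in> borel_measurable borel"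
  shows "(LBINT x. f (x + c)) = (LBINT x. f x)"
proof -
  have "(LBINT x. f x) = (\<integral>x. f x \<partial>distr lborel borel ((+) c))"
    by (simp add: lborel_distr_plus)
  also have "\<dots> = (LBINT x. f (c + x))"
    using assms by (intro integral_distr) auto
  finally show ?thesis by (simp add: add.commute)
qed

lemma AE_lborel_translate:
  fixes P :: "'a::euclidean_space \<Rightarrow> bool"
  assumes "AE x in lborel. P x" "{x. P x} \<in> sets borel"
  shows "AE x in lborel. P (x + c)"
proof -
  have "AE x in distr lborel borel ((+) c). P x"
    using assms(1) unfolding lborel_distr_plus .
  then have "AE x in lborel. P (c + x)"
    using assms(2) by (subst (asm) AE_distr_iff) auto
  then show ?thesis by (simp add: add.commute)
qed

lemma continuous_on_integral_dominated:
  fixes f :: "'a::metric_space \<Rightarrow> 'b \<Rightarrow> real"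
  assumes "\<And>z. z \<in> S \<Longrightarrow> f z \<in> borel_measurable M" "\<And>w. continuous_on S (\<lambda>z. f z w)"
    and "\<And>z w. z \<in> S \<Longrightarrow> \<bar>f z w\<bar> \<le> B w" "integrable M B"
  shows "continuous_on S (\<lambda>z. \<integral>w. f z w \<partial>M)"
  unfolding continuous_on_sequentially
proof (intro allI ballI impI, elim conjE)
  fix X a assume a: "a \<in> S" and X: "\<forall>n. X n \<in> S" "X \<longlonglongrightarrow> a"
  have "(\<lambda>n. f (X n) w) \<longlonglongrightarrow> f a w" for w
    using assms(2)[of w] a X unfolding continuous_on_sequentially o_def by blast
  then have "(\<lambda>n. \<integral>w. f (X n) w \<partial>M) \<longlonglongrightarrow> (\<integral>w. f a w \<partial>M)"
    using a X(1) assms by (intro integral_dominated_convergence[where w = B]) auto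
  then show "((\<lambda>z. \<integral>w. f z w \<partial>M) \<circ> X) \<longlonglongrightarrow> (\<integral>w. f a w \<partial>M)"
    by (simp add: o_def)
qed

text \<open>The set where \<open>w\<close> is nonzero is open and null, hence empty. Identities that
  hold almost everywhere become pointwise in this way below.\<close>

lemma continuous_AE_eq_0:
  fixes w :: "'a::euclidean_space \<Rightarrow> real"
  assumes "open S" "continuous_on S w" "AE x in lborel. x \<in> S \<longrightarrow> w x = 0" "x \<in> S"
  shows "w x = 0"
proof (rule ccontr)
  assume "w x \<noteq> 0"
  let ?T = "S \<inter> w -` (- {0})"
  have "open ?T"
    using assms(1,2) by (intro continuous_open_preimage) auto
  moreover have "negligible ?T"
  proof -
    have "AE x in lborel. x \<notin> ?T" using assms(3) by (rule eventually_mono) auto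
    then have "?T \<in> null_sets lborel"
      using \<open>open ?T\<close> by (subst (asm) AE_iff_null_sets[symmetric]) auto
    then show ?thesis unfolding negligible_iff_null_sets by (rule null_sets_completionI)
  qed
  ultimately show False using open_not_negligible \<open>w x \<noteq> 0\<close> assms(4) by blast
qed

section \<open>Bump functions on boxes\<close>

text \<open>Not normalised: the values lie in [0, 1] for every \<open>m\<close>, which provides the
  dominating function in limits. Where the total mass matters, it is divided out.\<close>

definition bump :: "real \<Rightarrow> real^'n \<Rightarrow> real^'n \<Rightarrow> real^'n \<Rightarrow> real" where
  "bump m a b x = (\<Prod>j\<in>UNIV. flat_exp 0 (m * (x $ j - a $ j)) * flat_exp 0 (m * (b $ j - x $ j)))"

lemma flat_exp_0_le_1: "flat_exp 0 t \<le> 1"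
  by (simp add: flat_exp_def)

lemma bump_nonneg: "0 \<le> bump m a b x"
  unfolding bump_def by (intro prod_nonneg mult_nonneg_nonneg flat_exp_nonneg ballI)

lemma bump_le_1: "bump m a b x \<le> 1"
  unfolding bump_def by (intro prod_le_1 conjI mult_nonneg_nonneg mult_le_one flat_exp_nonneg flat_exp_0_le_1)

lemma bump_outside:
  assumes "m > 0" "x \<notin> box a b"
  shows "bump m a b x = 0"
proof -
  obtain j where "x $ j \<le> a $ j \<or> b $ j \<le> x $ j"
    using assms(2) by (auto simp: mem_box_cart not_less)
  then have "m * (x $ j - a $ j) \<le> 0 \<or> m * (b $ j - x $ j) \<le> 0"
    using assms(1) by (simp add: mult_le_0_iff)
  then have "flat_exp 0 (m * (x $ j - a $ j)) * flat_exp 0 (m * (b $ j - x $ j)) = 0"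
    by (auto simp: flat_exp_def)
  then show ?thesis
    unfolding bump_def by (intro prod_zero[OF finite bexI[of _ j]] UNIV_I)
qed

lemma bump_pos: "m > 0 \<Longrightarrow> x \<in> box a b \<Longrightarrow> bump m a b x > 0"
  unfolding bump_def by (intro prod_pos) (auto simp: flat_exp_def mem_box_cart)

text \<open>Translation stays within the family and is absorbed into the box.\<close>

lemma bump_shift: "bump m a b (x - y) = bump m (a + y) (b + y) x"
  by (simp add: bump_def algebra_simps)

lemma Ck_bump: "Ck k S (bump m a b)"
proof -
  have "Ck k S (\<lambda>x. \<Prod>j\<in>UNIV. flat_exp 0 (m * (x $ j + - a $ j)) * flat_exp 0 (m * (b $ j + (- 1) * x $ j)))"
    by (intro Ck_prod Ck_mult Ck_flat_exp Ck_add Ck_const Ck_coord)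
  then show ?thesis by (simp add: bump_def[abs_def])
qed

lemma continuous_on_bump: "continuous_on S (bump m a b)"
  by (rule Ck_continuous_on[OF Ck_bump])

lemma test_fun_bump:
  assumes "m > 0" "cbox a b \<subseteq> \<Omega>"
  shows "test_fun \<Omega> (bump m a b)"
proof -
  have "bump m a b x = 0" if "x \<notin> cbox a b" for x
    using bump_outside[OF assms(1)] that box_subset_cbox by blast
  then show ?thesis
    using assms(2) unfolding test_fun_def
    by (auto simp: smooth_real_on_iff_Ck Ck_bump intro!: exI[of _ "cbox a b"])
qed

lemma bump_tendsto_indicator:
  "(\<lambda>n. bump (real (Suc n)) a b x) \<longlonglongrightarrow> indicator (box a b) x"
proof (cases "x \<in> box a b")
  case False
  then show ?thesis by (simp add: bump_outside)
next
  case True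
  have lim: "(\<lambda>n. flat_exp 0 (real (Suc n) * c)) \<longlonglongrightarrow> 1" if "c > 0" for c
  proof -
    have "(\<lambda>n. exp (- (inverse (real (Suc n)) * inverse c))) \<longlonglongrightarrow> exp (- (0 * inverse c))"
      by (intro tendsto_intros LIMSEQ_inverse_real_of_nat)
    moreover have "flat_exp 0 (real (Suc n) * c) = exp (- (inverse (real (Suc n)) * inverse c))" for n
      using that by (simp add: flat_exp_def del: of_nat_Suc)
    ultimately show ?thesis by simp
  qed
  have "(\<lambda>n. bump (real (Suc n)) a b x) \<longlonglongrightarrow> (\<Prod>j\<in>(UNIV::'a set). 1 * 1)"
    unfolding bump_def using True by (intro tendsto_prod tendsto_mult lim) (auto simp: mem_box_cart)
  then show ?thesis using True by simp
qed

text \<open>Scaling the argument of \<open>flat_exp\<close> makes \<open>bump\<close> converge to the indicator of a box,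
  and the boxes are an intersection-stable generator of the Borel sets.\<close>

lemma AE_zero_of_bump_integrals:
  fixes w :: "real^'n \<Rightarrow> real"
  assumes w: "w \<in> borel_measurable borel" "\<And>x. \<bar>w x\<bar> \<le> C"
    and int: "\<And>m a b. m > 0 \<Longrightarrow> cbox a b \<subseteq> cbox p q \<Longrightarrow> (LBINT x. w x * bump m a b x) = 0"
  shows "AE x in lborel. x \<in> box p q \<longrightarrow> w x = 0"
proof -
  have C: "0 \<le> C" using w(2)[of 0] by linarith
  have box_meas: "bump m a b \<in> borel_measurable borel" for m and a b :: "real^'n"
    by (intro borel_measurable_continuous_onI continuous_on_bump)
  have box0: "(LBINT x. w x * indicator (box a b) x) = 0" if ab: "cbox a b \<subseteq> cbox p q" for a b
  proof -
    have "(\<lambda>n. LBINT x. w x * bump (real (Suc n)) a b x) \<longlonglongrightarrow> (LBINT x. w x * indicator (box a b) x)"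
    proof (rule integral_dominated_convergence[where w = "\<lambda>x. C * indicator (cbox a b) x"])
      show "integrable lborel (\<lambda>x. C * indicator (cbox a b) x)"
        using C by (intro integrable_bounded_support[where C = C and S = "cbox a b"]) (auto simp: indicator_def)
      show "AE x in lborel. (\<lambda>n. w x * bump (real (Suc n)) a b x) \<longlonglongrightarrow> w x * indicator (box a b) x"
        by (intro AE_I2 tendsto_mult tendsto_const bump_tendsto_indicator)
      show "AE x in lborel. norm (w x * bump (real (Suc n)) a b x) \<le> C * indicator (cbox a b) x" for n
      proof (intro AE_I2)
        fix x
        show "norm (w x * bump (real (Suc n)) a b x) \<le> C * indicator (cbox a b) x"
        proof (cases "x \<in> cbox a b")
          case True
          have "\<bar>w x\<bar> * bump (real (Suc n)) a b x \<le> C * 1"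
            using C w(2) by (intro mult_mono bump_le_1 bump_nonneg)
          then show ?thesis using True by (simp add: abs_mult bump_nonneg)
        next
          case False
          then have "x \<notin> box a b" using box_subset_cbox by blast
          then show ?thesis using C by (simp add: bump_outside)
        qed
      qed
    qed (use w(1) box_meas in auto)
    then show ?thesis using int[OF _ ab] by (simp add: LIMSEQ_const_iff)
  qed
  \<comment> \<open>Cutting off outside \<open>box p q\<close> allows arbitrary boxes as test sets:
    a nonempty intersection with \<open>box p q\<close> is again a box, to which \<open>box0\<close>
    applies.\<close>
  define v where "v x = w x * indicator (box p q) x" for x
  have v: "v \<in> borel_measurable borel" using w(1) by (simp add: v_def[abs_def])
  have vC: "\<bar>v x\<bar> \<le> C" for x using w(2)[of x] C by (auto simp: v_def indicator_def)
  have v_box: "(LBINT x. v x * indicator (box a b) x) = 0" for a b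
  proof (cases "box a b \<inter> box p q = {}")
    case True
    then have "v x * indicator (box a b) x = 0" for x by (auto simp: v_def indicator_def)
    then show ?thesis by (simp only: Bochner_Integration.integral_zero)
  next
    case False
    obtain c d where cd: "box a b \<inter> box p q = box c d" using box_Int_box[of a b p q] by blast
    have "box c d \<noteq> {}" "box p q \<noteq> {}" using False cd by auto
    moreover have "closure (box c d) \<subseteq> closure (box p q)"
      using cd by (intro closure_mono) blast
    ultimately have "cbox c d \<subseteq> cbox p q" by (simp add: closure_box)
    then have "(LBINT x. w x * indicator (box c d) x) = 0" by (rule box0)
    moreover have "v x * indicator (box a b) x = w x * indicator (box c d) x" for x
      by (simp add: v_def cd[symmetric] indicator_inter_arith mult_ac)
    ultimately show ?thesis by simp
  qed
  \<comment> \<open>The positive and negative parts of \<open>v\<close> become densities. The two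
    measures agree on all boxes, hence are equal; so their densities agree almost everywhere, which
    leaves \<open>v = 0\<close> there.\<close>
  let ?P = "density lborel (\<lambda>x. ennreal (max 0 (v x)))" and ?N = "density lborel (\<lambda>x. ennreal (max 0 (- v x)))"
  have emeasure_density_box: "emeasure (density lborel (\<lambda>x. ennreal (max 0 (f x)))) (box a b) =
      ennreal (LBINT x. max 0 (f x) * indicator (box a b) x) \<and> integrable lborel (\<lambda>x. max 0 (f x) * indicator (box a b) x)"
    if f: "f \<in> borel_measurable borel" "\<And>x. \<bar>f x\<bar> \<le> C" for a b :: "real^'n" and f
  proof -
    have I: "integrable lborel (\<lambda>x. max 0 (f x) * indicator (box a b) x)"
      using f C by (intro integrable_bounded_support[where C = C and S = "box a b"])
        (auto simp: indicator_def max_def abs_le_iff)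
    have "emeasure (density lborel (\<lambda>x. ennreal (max 0 (f x)))) (box a b) =
        (\<integral>\<^sup>+x. ennreal (max 0 (f x) * indicator (box a b) x) \<partial>lborel)"
      using f(1) by (subst emeasure_density) (auto intro!: nn_integral_cong simp: indicator_def)
    then show ?thesis using I by (simp add: nn_integral_eq_integral)
  qed
  have mv: "(\<lambda>x. - v x) \<in> borel_measurable borel" "\<bar>- v x\<bar> \<le> C" for x using v vC by auto
  have "?P = ?N"
  proof (rule measure_eqI_generator_eq[where E = "range (\<lambda>(a, b). box a b)" and \<Omega> = UNIV
        and A = "\<lambda>n::nat. box (- (real n *\<^sub>R One)) (real n *\<^sub>R One)"])
    show "Int_stable (range (\<lambda>(a::real^'n, b). box a b))"
      by (auto simp: Int_stable_def box_Int_box)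
    show "emeasure ?P X = emeasure ?N X" if E: "X \<in> range (\<lambda>(a, b). box a b)" for X
    proof -
      obtain a b where X: "X = box a b" using E by auto
      have "(LBINT x. max 0 (v x) * indicator (box a b) x) - (LBINT x. max 0 (- v x) * indicator (box a b) x) =
          (LBINT x. max 0 (v x) * indicator (box a b) x - max 0 (- v x) * indicator (box a b) x)"
        using emeasure_density_box[OF v vC] emeasure_density_box[OF mv]
        by (intro Bochner_Integration.integral_diff[symmetric]) auto
      also have "\<dots> = (LBINT x. v x * indicator (box a b) x)"
        by (intro Bochner_Integration.integral_cong) (auto simp: max_def indicator_def)
      finally show ?thesis
        using emeasure_density_box[OF v vC] emeasure_density_box[OF mv] v_box by (simp add: X)
    qed
    show "\<Union> (range (\<lambda>n::nat. box (- (real n *\<^sub>R One)) (real n *\<^sub>R One))) = (UNIV :: (real^'n) set)"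
      unfolding UN_box_eq_UNIV ..
    show "emeasure ?P (box (- (real n *\<^sub>R One)) (real n *\<^sub>R One)) \<noteq> \<infinity>" for n :: nat
      using emeasure_density_box[OF v vC] by simp
  qed (auto simp: borel_eq_box)
  with _ _ have "AE x in lborel. ennreal (max 0 (v x)) = ennreal (max 0 (- v x))"
    by (rule sigma_finite_measure.density_unique[OF lborel.sigma_finite_measure_axioms])
      (use v in measurable)
  then show ?thesis
    by (rule eventually_mono) (auto simp: v_def max_def split: if_splits)
qed

definition bump_deriv :: "'n \<Rightarrow> real \<Rightarrow> real^'n \<Rightarrow> real^'n \<Rightarrow> real^'n::finite \<Rightarrow> real" where
  "bump_deriv j m a b = ipd [j] (bump m a b)"

lemma abs_bump_le_1: "\<bar>bump m a b x\<bar> \<le> 1"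
  using bump_nonneg[of m a b x] bump_le_1[of m a b x] by linarith

lemma borel_measurable_component [measurable]:
  "f \<in> borel_measurable M \<Longrightarrow> (\<lambda>x. f x $ j :: real) \<in> borel_measurable M"
  using measurable_compose[of f M borel "\<lambda>v. v $ j" borel]
  by (simp add: borel_measurable_continuous_onI continuous_on_component)

text \<open>\<open>Ck\<close> speaks of partial derivatives only; a total derivative is needed to
  differentiate along an arbitrary direction in \<open>bump_increment\<close>.\<close>

lemma bump_differentiable: "\<exists>D. (bump m a b has_derivative D) (at x)"
proof -
  have fe: "(flat_exp 0 has_derivative (*) (flat_exp 2 t)) (at t)" for t
    using DERIV_flat_exp[of 0 t] by (simp add: has_field_derivative_def numeral_2_eq_2)
  have "\<exists>D. ((\<lambda>x. flat_exp 0 (m * (x $ j - a $ j)) * flat_exp 0 (m * (b $ j - x $ j))) has_derivative D) (at x)" for j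
  proof -
    have "((\<lambda>x. x $ j) has_derivative (\<lambda>v. v $ j)) (at x)"
      by (rule bounded_linear_imp_has_derivative[OF bounded_linear_vec_nth])
    then have d: "((\<lambda>x. m * (x $ j - a $ j)) has_derivative (\<lambda>v. m * v $ j)) (at x)"
      "((\<lambda>x. m * (b $ j - x $ j)) has_derivative (\<lambda>v. m * - v $ j)) (at x)"
      by (auto intro!: derivative_eq_intros)
    from has_derivative_mult[OF has_derivative_compose[OF d(1) fe] has_derivative_compose[OF d(2) fe]]
    show ?thesis by blast
  qed
  then have "\<forall>j. \<exists>D. ((\<lambda>x. flat_exp 0 (m * (x $ j - a $ j)) * flat_exp 0 (m * (b $ j - x $ j))) has_derivative D) (at x)" ..
  from choice[OF this] obtain D where
    D: "\<And>j. ((\<lambda>x. flat_exp 0 (m * (x $ j - a $ j)) * flat_exp 0 (m * (b $ j - x $ j))) has_derivative D j) (at x)"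
    by blast
  show ?thesis
    unfolding bump_def[abs_def] by (rule exI, rule has_derivative_prod, rule D)
qed

lemma has_derivative_bump:
  "(bump m a b has_derivative (\<lambda>v. \<Sum>j\<in>UNIV. v $ j * bump_deriv j m a b x)) (at x)"
proof -
  obtain D where D: "(bump m a b has_derivative D) (at x)"
    using bump_differentiable by blast
  interpret D: bounded_linear D using D by (rule has_derivative_bounded_linear)
  have d: "bump_deriv j m a b x = D (axis j 1)" for j
  proof -
    have "((\<lambda>t. x + t *\<^sub>R axis j 1) has_derivative (\<lambda>t. t *\<^sub>R axis j 1)) (at 0)"
      by (auto intro!: derivative_eq_intros)
    moreover have "(bump m a b has_derivative D) (at (x + 0 *\<^sub>R axis j 1))"
      using D by simp
    ultimately have "((\<lambda>t. bump m a b (x + t *\<^sub>R axis j 1)) has_derivative (\<lambda>t. D (t *\<^sub>R axis j 1))) (at 0)"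
      by (rule has_derivative_compose)
    then have "has_partial (bump m a b) j (D (axis j 1)) x"
      by (simp add: has_field_derivative_def D.scaleR mult_commute_abs)
    then show ?thesis using DERIV_imp_deriv by (simp add: bump_deriv_def)
  qed
  have "D v = (\<Sum>j\<in>UNIV. v $ j * D (axis j 1))" for v
  proof -
    have "D v = D (\<Sum>j\<in>UNIV. v $ j *\<^sub>R axis j 1)"
      using basis_expansion[of v] by (simp add: scalar_mult_eq_scaleR)
    then show ?thesis by (simp add: D.sum D.scaleR)
  qed
  then have "D = (\<lambda>v. \<Sum>j\<in>UNIV. v $ j * bump_deriv j m a b x)"
    unfolding d by (rule ext)
  from this D show ?thesis
    by (rule subst[where P = "\<lambda>X. (bump m a b has_derivative X) (at x)"])
qed

lemma bump_deriv_shift: "bump_deriv j m a b (x - y) = bump_deriv j m (a + y) (b + y) x"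
  by (simp add: bump_deriv_def bump_shift[symmetric] algebra_simps)

lemma continuous_on_bump_deriv: "continuous_on S (bump_deriv j m a b)"
proof -
  have "smooth_real_on UNIV (bump m a b)" by (simp add: smooth_real_on_iff_Ck Ck_bump)
  then have "continuous_on UNIV (bump_deriv j m a b)"
    unfolding smooth_real_on_def bump_deriv_def by blast
  then show ?thesis by (rule continuous_on_subset) simp
qed

lemma borel_measurable_bump [measurable (raw)]:
  "f \<in> borel_measurable M \<Longrightarrow> (\<lambda>x. bump m a b (f x)) \<in> borel_measurable M"
  by (rule measurable_compose[OF _ borel_measurable_continuous_onI[OF continuous_on_bump]])

lemma borel_measurable_bump_deriv [measurable (raw)]:
  "f \<in> borel_measurable M \<Longrightarrow> (\<lambda>x. bump_deriv j m a b (f x)) \<in> borel_measurable M"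
  by (rule measurable_compose[OF _ borel_measurable_continuous_onI[OF continuous_on_bump_deriv]])

lemma bump_deriv_outside:
  assumes "m > 0" "x \<notin> cbox a b"
  shows "bump_deriv j m a b x = 0"
proof -
  have "bump m a b y = 0" if "y \<in> - cbox a b" for y
    using bump_outside[OF assms(1)] box_subset_cbox that by blast
  then have "has_partial (bump m a b) j 0 x \<longleftrightarrow> has_partial (\<lambda>_. 0) j 0 x"
    using assms(2) by (intro has_partial_cong[of "- cbox a b"]) (auto simp: closed_cbox open_Compl)
  then show ?thesis using DERIV_imp_deriv by (simp add: bump_deriv_def)
qed

lemma bump_deriv_bounded:
  assumes "m > 0"
  obtains B where "\<And>x j. \<bar>bump_deriv j m a b x\<bar> \<le> B"
proof -
  have "\<exists>B. \<forall>x\<in>cbox a b. norm (bump_deriv j m a b x) \<le> B" for j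
    using compact_imp_bounded[OF compact_continuous_image[OF continuous_on_bump_deriv compact_cbox]]
    unfolding bounded_iff by (metis imageI)
  then obtain B where B: "\<And>j x. x \<in> cbox a b \<Longrightarrow> \<bar>bump_deriv j m a b x\<bar> \<le> B j"
    by (metis real_norm_def)
  have "\<bar>bump_deriv j m a b x\<bar> \<le> (\<Sum>j\<in>UNIV. \<bar>B j\<bar>)" for x j
  proof (cases "x \<in> cbox a b")
    case True
    have "\<bar>bump_deriv j m a b x\<bar> \<le> \<bar>B j\<bar>" using B[OF True, of j] by linarith
    also have "\<dots> \<le> (\<Sum>j\<in>UNIV. \<bar>B j\<bar>)" by (rule member_le_sum) auto
    finally show ?thesis .
  next
    case False
    then show ?thesis by (subst bump_deriv_outside[OF assms False]) (simp add: sum_nonneg)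
  qed
  then show thesis by (rule that)
qed

text \<open>The fundamental theorem along the segment from \<open>x\<close> to \<open>x - y\<close>.
  It runs backwards because translating \<open>u\<close> by \<open>y\<close> under an integral moves
  the argument of the test function to \<open>x - y\<close>.\<close>

lemma bump_increment:
  "bump m a b (x - y) - bump m a b x =
    (LBINT s. (- (\<Sum>j\<in>UNIV. y $ j * bump_deriv j m a b (x - s *\<^sub>R y))) * indicator {0..1} s)"
proof -
  have D: "((\<lambda>s. bump m a b (x - s *\<^sub>R y)) has_real_derivative
      - (\<Sum>j\<in>UNIV. y $ j * bump_deriv j m a b (x - s *\<^sub>R y))) (at s)" for s
  proof -
    have "((\<lambda>s. x - s *\<^sub>R y) has_derivative (\<lambda>t. - (t *\<^sub>R y))) (at s)"
      by (auto intro!: derivative_eq_intros)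
    from has_derivative_compose[OF this has_derivative_bump]
    have "((\<lambda>s. bump m a b (x - s *\<^sub>R y)) has_derivative
        (\<lambda>t. \<Sum>j\<in>UNIV. (- (t *\<^sub>R y)) $ j * bump_deriv j m a b (x - s *\<^sub>R y))) (at s)" .
    moreover have "(\<lambda>t. \<Sum>j\<in>UNIV. (- (t *\<^sub>R y)) $ j * bump_deriv j m a b (x - s *\<^sub>R y)) =
        (*) (- (\<Sum>j\<in>UNIV. y $ j * bump_deriv j m a b (x - s *\<^sub>R y)))"
      by (auto simp: fun_eq_iff sum_negf sum_distrib_left mult_ac)
    ultimately show ?thesis by (simp add: has_field_derivative_def)
  qed
  have "isCont (\<lambda>s. - (\<Sum>j\<in>UNIV. y $ j * bump_deriv j m a b (x - s *\<^sub>R y))) s" for s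
  proof -
    have "isCont (bump_deriv j m a b) (x - s *\<^sub>R y)" for j
      using continuous_on_bump_deriv[of UNIV] by (metis UNIV_I open_UNIV continuous_on_eq_continuous_at)
    then show ?thesis
      by (intro continuous_intros isCont_o2[where f = "\<lambda>s. x - s *\<^sub>R y"])
  qed
  then show ?thesis
    using integral_FTC_Icc_real[of 0 1, OF _ D] by simp
qed

text \<open>The value of \<open>u (x + y) - u x\<close> if \<open>h\<close> is the gradient of \<open>u\<close> and the segment stays in its domain.\<close>

definition increment :: "('n \<Rightarrow> real^'n \<Rightarrow> real) \<Rightarrow> real^'n::finite \<Rightarrow> real^'n \<Rightarrow> real" where
  "increment h x y = (LBINT s. indicator {0..1} s * (\<Sum>j\<in>UNIV. y $ j * h j (x + s *\<^sub>R y)))"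

section \<open>The fundamental theorem along segments for weak gradients\<close>

text \<open>Bounds and Borel measurability hold on the whole space, so that translates and iterated
  integrals need no restriction of the domain; continuity of \<open>h\<close> is confined to
  \<Omega>.\<close>

locale weak_gradient =
  fixes \<Omega> :: "(real^'n::finite) set" and u :: "real^'n \<Rightarrow> real" and h :: "'n \<Rightarrow> real^'n \<Rightarrow> real" and C :: real
  assumes open_\<Omega>: "open \<Omega>"
    and u_meas [measurable]: "u \<in> borel_measurable borel" and u_bound: "\<And>x. \<bar>u x\<bar> \<le> C"
    and h_meas [measurable]: "\<And>j. h j \<in> borel_measurable borel" and h_bound: "\<And>j x. \<bar>h j x\<bar> \<le> C"
    and h_cont: "\<And>j. continuous_on \<Omega> (h j)"
    and weak: "\<And>\<phi> j. test_fun \<Omega> \<phi> \<Longrightarrow> (LBINT x. u x * ipd [j] \<phi> x) = - (LBINT x. h j x * \<phi> x)"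
begin

lemma C_nonneg: "0 \<le> C"
  using u_bound[of 0] by linarith

lemma integrand_bound: "\<bar>\<Sum>j\<in>UNIV. y $ j * h j z\<bar> \<le> (\<Sum>j\<in>UNIV. \<bar>y $ j\<bar>) * C"
proof -
  have "\<bar>\<Sum>j\<in>UNIV. y $ j * h j z\<bar> \<le> (\<Sum>j\<in>UNIV. \<bar>y $ j\<bar> * C)"
    using h_bound by (intro order_trans[OF sum_abs] sum_mono) (simp add: abs_mult mult_left_mono)
  then show ?thesis by (simp add: sum_distrib_right)
qed

lemma borel_measurable_increment [measurable (raw)]:
  assumes [measurable]: "f \<in> borel_measurable M" "g \<in> borel_measurable M"
  shows "(\<lambda>x. increment h (f x) (g x)) \<in> borel_measurable M"
proof -
  have "(\<lambda>(x, s). indicator {0..1::real} s * (\<Sum>j\<in>UNIV. g x $ j * h j (f x + s *\<^sub>R g x)))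
      \<in> borel_measurable (M \<Otimes>\<^sub>M lborel)"
    by measurable
  from lborel.borel_measurable_lebesgue_integral[OF this] show ?thesis
    by (simp add: increment_def)
qed

lemma increment_bound: "\<bar>increment h x y\<bar> \<le> (\<Sum>j\<in>UNIV. \<bar>y $ j\<bar>) * C"
proof -
  let ?f = "\<lambda>s. indicator {0..1::real} s * (\<Sum>j\<in>UNIV. y $ j * h j (x + s *\<^sub>R y))"
  let ?B = "(\<Sum>j\<in>UNIV. \<bar>y $ j\<bar>) * C"
  have B: "0 \<le> ?B" using C_nonneg by (simp add: sum_nonneg)
  have f: "\<bar>?f s\<bar> \<le> indicator {0..1} s * ?B" for s :: real
    using integrand_bound by (simp add: indicator_def)
  have "\<bar>LBINT s. ?f s\<bar> \<le> (LBINT s. \<bar>?f s\<bar>)"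
    by (rule integral_abs_bound)
  also have "\<dots> \<le> (LBINT s. indicator {0..1::real} s * ?B)"
  proof (rule Bochner_Integration.integral_mono)
    have "integrable lborel ?f"
    proof (rule integrable_bounded_support[where S = "{0..1}" and C = ?B])
      show "\<bar>?f s\<bar> \<le> ?B" for s using integrand_bound B by (simp add: indicator_def)
    qed auto
    then show "integrable lborel (\<lambda>s. \<bar>?f s\<bar>)" by simp
    show "integrable lborel (\<lambda>s. indicator {0..1::real} s * ?B)"
      using B by (intro integrable_bounded_support[where S = "{0..1}" and C = ?B]) (auto simp: indicator_def)
  qed (rule f)
  finally show ?thesis by (simp add: increment_def)
qed

lemma weak_shifted:
  assumes m: "m > 0" and sub: "cbox (a + y) (b + y) \<subseteq> \<Omega>"
  shows "(LBINT x. u x * bump_deriv j m a b (x - y)) = - (LBINT z. h j (z + y) * bump m a b z)"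
proof -
  have "(LBINT x. u x * bump_deriv j m a b (x - y)) = - (LBINT x. h j x * bump m a b (x - y))"
    unfolding bump_deriv_shift bump_shift unfolding bump_deriv_def by (rule weak[OF test_fun_bump[OF m sub]])
  also have "(LBINT x. h j x * bump m a b (x - y)) = (LBINT z. h j (z + y) * bump m a b (z + y - y))"
    by (intro integral_lborel_translate[symmetric]) measurable
  finally show ?thesis by simp
qed

text \<open>Translation moves the difference from \<open>u\<close> to the bump, whose increment is
  an integral of its derivative along the segment. For each \<open>s\<close> the weak derivative
  turns this into \<open>h\<close>, provided that the box translated by \<open>s *\<^sub>R y\<close>
  lies in \<Omega>; the integral over \<open>s\<close> is taken outside for this step and inside
  again afterwards.\<close>

lemma integral_increment:
  assumes m: "m > 0" and sub: "\<And>s. 0 \<le> s \<Longrightarrow> s \<le> 1 \<Longrightarrow> cbox (a + s *\<^sub>R y) (b + s *\<^sub>R y) \<subseteq> \<Omega>"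
  shows "(LBINT z. bump m a b z * (u (z + y) - u z - increment h z y)) = 0"
proof -
  let ?\<phi> = "bump m a b"
  obtain B where B: "\<And>x j. \<bar>bump_deriv j m a b x\<bar> \<le> B" using bump_deriv_bounded[OF m] by blast
  have B0: "0 \<le> B" using B[of undefined 0] by linarith
  obtain R where R: "\<And>z. z \<in> cbox a b \<Longrightarrow> norm z \<le> R"
    using bounded_cbox[of a b] unfolding bounded_iff by blast
  define Y where "Y = (\<Sum>j\<in>UNIV. \<bar>y $ j\<bar>)"
  have Y0: "0 \<le> Y" by (simp add: Y_def sum_nonneg)
  have int_shift: "integrable lborel (\<lambda>x. u x * bump_deriv j m a b (x - s *\<^sub>R y))" for s j
  proof (rule integrable_bounded_support[where C = "C * B" and S = "cbox (a + s *\<^sub>R y) (b + s *\<^sub>R y)"])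
    show "\<bar>u x * bump_deriv j m a b (x - s *\<^sub>R y)\<bar> \<le> C * B" for x
      unfolding abs_mult using u_bound B C_nonneg by (intro mult_mono) auto
    show "u x * bump_deriv j m a b (x - s *\<^sub>R y) = 0" if "x \<notin> cbox (a + s *\<^sub>R y) (b + s *\<^sub>R y)" for x
      using bump_deriv_outside[OF m that, of j] bump_deriv_shift[of j m a b x "s *\<^sub>R y"] by simp
  qed (simp_all add: bounded_cbox)
  have int_h: "integrable lborel (\<lambda>z. h j (z + s *\<^sub>R y) * ?\<phi> z)" for s j
  proof (rule integrable_bounded_support[where C = "C * 1" and S = "cbox a b"])
    show "\<bar>h j (z + s *\<^sub>R y) * ?\<phi> z\<bar> \<le> C * 1" for z
      unfolding abs_mult using h_bound abs_bump_le_1 C_nonneg by (intro mult_mono) auto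
    show "h j (z + s *\<^sub>R y) * ?\<phi> z = 0" if "z \<notin> cbox a b" for z
      using bump_outside[OF m] that box_subset_cbox[of a b] by auto
  qed (simp_all add: bounded_cbox)
  have "(LBINT x. u x * (?\<phi> (x - y) - ?\<phi> x)) =
      (LBINT x. LBINT s. u x * ((- (\<Sum>j\<in>UNIV. y $ j * bump_deriv j m a b (x - s *\<^sub>R y))) * indicator {0..1} s))"
    unfolding bump_increment by simp
  also have "\<dots> = (LBINT s. LBINT x. u x * ((- (\<Sum>j\<in>UNIV. y $ j * bump_deriv j m a b (x - s *\<^sub>R y))) * indicator {0..1} s))"
  \<comment> \<open>If \<open>x - s *\<^sub>R y\<close> lies in the box for some \<open>s\<close> in
    [0, 1], then \<open>norm x \<le> R + norm y\<close>; hence this ball.\<close>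
  proof (rule Fubini_bounded_support[where C = "C * (Y * B)" and S = "cball 0 (R + norm y)" and T = "{0..1}"])
    have "\<bar>(\<Sum>j\<in>UNIV. y $ j * bump_deriv j m a b z)\<bar> \<le> (\<Sum>j\<in>UNIV. \<bar>y $ j\<bar> * B)" for z
      using B by (intro order_trans[OF sum_abs] sum_mono) (simp add: abs_mult mult_left_mono)
    then have "\<bar>(\<Sum>j\<in>UNIV. y $ j * bump_deriv j m a b z)\<bar> \<le> Y * B" for z
      by (simp add: Y_def sum_distrib_right)
    then show "\<bar>u x * ((- (\<Sum>j\<in>UNIV. y $ j * bump_deriv j m a b (x - s *\<^sub>R y))) * indicator {0..1} s)\<bar> \<le> C * (Y * B)" for x s
      unfolding abs_mult abs_minus using u_bound C_nonneg Y0 B0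
      by (intro mult_mono order_trans[OF mult_right_le_one_le]) (auto simp: indicator_def)
    show "u x * ((- (\<Sum>j\<in>UNIV. y $ j * bump_deriv j m a b (x - s *\<^sub>R y))) * indicator {0..1} s) = 0"
      if xs: "x \<notin> cball 0 (R + norm y) \<or> s \<notin> {0..1}" for x s
    proof (cases "s \<in> {0..1}")
      case True
      have "x - s *\<^sub>R y \<notin> cbox a b"
      proof
        assume "x - s *\<^sub>R y \<in> cbox a b"
        then have "norm (x - s *\<^sub>R y) \<le> R" by (rule R)
        moreover have "norm (s *\<^sub>R y) \<le> norm y" using True by (auto intro: mult_left_le_one_le)
        moreover have "norm x \<le> norm (x - s *\<^sub>R y) + norm (s *\<^sub>R y)"
          using norm_triangle_ineq[of "x - s *\<^sub>R y" "s *\<^sub>R y"] by simp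
        ultimately show False using xs True by auto
      qed
      then have "bump_deriv j m a b (x - s *\<^sub>R y) = 0" for j by (rule bump_deriv_outside[OF m])
      then show ?thesis by simp
    qed simp
    show "(\<lambda>(x, s). u x * ((- (\<Sum>j\<in>UNIV. y $ j * bump_deriv j m a b (x - s *\<^sub>R y))) * indicator {0..1} s)) \<in> borel_measurable borel"
      unfolding borel_prod[symmetric] by measurable
  qed auto
  also have "\<dots> = (LBINT s. LBINT z. ?\<phi> z * (indicator {0..1} s * (\<Sum>j\<in>UNIV. y $ j * h j (z + s *\<^sub>R y))))"
  proof (rule Bochner_Integration.integral_cong[OF refl])
    fix s :: real
    show "(LBINT x. u x * ((- (\<Sum>j\<in>UNIV. y $ j * bump_deriv j m a b (x - s *\<^sub>R y))) * indicator {0..1} s)) =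
        (LBINT z. ?\<phi> z * (indicator {0..1} s * (\<Sum>j\<in>UNIV. y $ j * h j (z + s *\<^sub>R y))))"
    proof (cases "s \<in> {0..1}")
      case True
      have "(LBINT x. u x * (- (\<Sum>j\<in>UNIV. y $ j * bump_deriv j m a b (x - s *\<^sub>R y)))) =
          (LBINT x. (\<Sum>j\<in>UNIV. (- y $ j) * (u x * bump_deriv j m a b (x - s *\<^sub>R y))))"
        by (simp add: sum_distrib_left sum_negf mult_ac)
      also have "\<dots> = (\<Sum>j\<in>UNIV. (- y $ j) * (LBINT x. u x * bump_deriv j m a b (x - s *\<^sub>R y)))"
        using int_shift by (subst Bochner_Integration.integral_sum) auto
      \<comment> \<open>The sign from the weak derivative cancels the sign from the backward
        segment.\<close>
      also have "\<dots> = (\<Sum>j\<in>UNIV. y $ j * (LBINT z. h j (z + s *\<^sub>R y) * ?\<phi> z))"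
        using True by (subst weak_shifted[OF m sub]) auto
      also have "\<dots> = (LBINT z. (\<Sum>j\<in>UNIV. y $ j * (h j (z + s *\<^sub>R y) * ?\<phi> z)))"
        using int_h by (subst Bochner_Integration.integral_sum) auto
      also have "\<dots> = (LBINT z. ?\<phi> z * (\<Sum>j\<in>UNIV. y $ j * h j (z + s *\<^sub>R y)))"
        by (simp add: sum_distrib_left mult_ac)
      finally show ?thesis using True by simp
    qed simp
  qed
  also have "\<dots> = (LBINT z. LBINT s. ?\<phi> z * (indicator {0..1} s * (\<Sum>j\<in>UNIV. y $ j * h j (z + s *\<^sub>R y))))"
  proof (rule Fubini_bounded_support[symmetric, where C = "1 * (1 * (Y * C))" and S = "cbox a b" and T = "{0..1}"])
    show "\<bar>?\<phi> z * (indicator {0..1} s * (\<Sum>j\<in>UNIV. y $ j * h j (z + s *\<^sub>R y)))\<bar> \<le> 1 * (1 * (Y * C))" for z s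
      unfolding abs_mult Y_def using C_nonneg abs_bump_le_1 integrand_bound
      by (intro mult_mono) (auto simp: indicator_def sum_nonneg)
    show "?\<phi> z * (indicator {0..1} s * (\<Sum>j\<in>UNIV. y $ j * h j (z + s *\<^sub>R y))) = 0"
      if "z \<notin> cbox a b \<or> s \<notin> {0..1}" for z s
      using that bump_outside[OF m] box_subset_cbox[of a b] by auto
    show "(\<lambda>(z, s). ?\<phi> z * (indicator {0..1} s * (\<Sum>j\<in>UNIV. y $ j * h j (z + s *\<^sub>R y)))) \<in> borel_measurable borel"
      unfolding borel_prod[symmetric] by measurable
  qed auto
  also have "\<dots> = (LBINT z. ?\<phi> z * increment h z y)"
    by (simp add: increment_def)
  finally have incr: "(LBINT x. u x * (?\<phi> (x - y) - ?\<phi> x)) = (LBINT z. ?\<phi> z * increment h z y)" .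
  have int_u: "integrable lborel (\<lambda>z. ?\<phi> z * u (z + c))" for c
  proof (rule integrable_bounded_support[where C = "1 * C" and S = "cbox a b"])
    show "\<bar>?\<phi> z * u (z + c)\<bar> \<le> 1 * C" for z
      unfolding abs_mult using u_bound abs_bump_le_1 C_nonneg by (intro mult_mono) auto
    show "?\<phi> z * u (z + c) = 0" if "z \<notin> cbox a b" for z
      using bump_outside[OF m] that box_subset_cbox[of a b] by auto
  qed (simp_all add: bounded_cbox)
  have int_shift_\<phi>: "integrable lborel (\<lambda>x. u x * ?\<phi> (x - y))"
  proof (rule integrable_bounded_support[where C = "C * 1" and S = "cbox (a + y) (b + y)"])
    show "\<bar>u x * ?\<phi> (x - y)\<bar> \<le> C * 1" for x
      unfolding abs_mult using u_bound abs_bump_le_1 C_nonneg by (intro mult_mono) auto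
    show "u x * ?\<phi> (x - y) = 0" if "x \<notin> cbox (a + y) (b + y)" for x
      using bump_outside[OF m] that box_subset_cbox[of "a + y" "b + y"] by (auto simp: bump_shift)
  qed (simp_all add: bounded_cbox)
  have int_incr: "integrable lborel (\<lambda>z. ?\<phi> z * increment h z y)"
  proof (rule integrable_bounded_support[where C = "1 * (Y * C)" and S = "cbox a b"])
    show "\<bar>?\<phi> z * increment h z y\<bar> \<le> 1 * (Y * C)" for z
      unfolding abs_mult Y_def using increment_bound abs_bump_le_1 C_nonneg
      by (intro mult_mono) (auto simp: sum_nonneg)
    show "?\<phi> z * increment h z y = 0" if "z \<notin> cbox a b" for z
      using bump_outside[OF m] that box_subset_cbox[of a b] by auto
  qed (simp_all add: bounded_cbox)
  have "(LBINT x. u x * ?\<phi> (x - y)) = (LBINT z. u (z + y) * ?\<phi> (z + y - y))"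
    by (intro integral_lborel_translate[symmetric]) measurable
  then have "(LBINT x. u x * (?\<phi> (x - y) - ?\<phi> x)) = (LBINT z. ?\<phi> z * u (z + y)) - (LBINT z. ?\<phi> z * u (z + 0))"
    using int_shift_\<phi> int_u[of 0] by (simp add: right_diff_distrib mult.commute)
  then show ?thesis
    using incr int_u[of y] int_u[of 0] int_incr by (simp add: right_diff_distrib)
qed

end

lemma mem_cbox_translate:
  fixes a b c x :: "real^'n"
  shows "x \<in> cbox (a + c) (b + c) \<longleftrightarrow> x - c \<in> cbox a b"
  by (simp add: mem_box_cart algebra_simps)

lemma mem_cube:
  fixes x x0 :: "real^'n"
  shows "x \<in> cbox (x0 - vec r) (x0 + vec r) \<longleftrightarrow> (\<forall>i. \<bar>x $ i - x0 $ i\<bar> \<le> r)"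
    and "x \<in> box (x0 - vec r) (x0 + vec r) \<longleftrightarrow> (\<forall>i. \<bar>x $ i - x0 $ i\<bar> < r)"
  by (auto simp: mem_box_cart abs_le_iff abs_less_iff algebra_simps)

lemma open_contains_cube:
  fixes x0 :: "real^'n"
  assumes "open \<Omega>" "x0 \<in> \<Omega>"
  obtains r where "r > 0" "cbox (x0 - vec r) (x0 + vec r) \<subseteq> \<Omega>"
proof -
  obtain e where e: "e > 0" "cball x0 e \<subseteq> \<Omega>"
    using assms open_contains_cball by blast
  \<comment> \<open>The Euclidean norm is at most the sum of the absolute coordinates, so this
    half-width keeps the cube inside the ball of radius \<open>e\<close>.\<close>
  let ?r = "e / real CARD('n)"
  have "x \<in> cball x0 e" if "x \<in> cbox (x0 - vec ?r) (x0 + vec ?r)" for x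
  proof -
    have "norm (x - x0) \<le> (\<Sum>i\<in>UNIV. \<bar>(x - x0) $ i\<bar>)" by (rule norm_le_l1_cart)
    also have "\<dots> \<le> (\<Sum>i\<in>(UNIV::'n set). ?r)"
      using that by (intro sum_mono) (simp add: mem_cube)
    finally show ?thesis by (simp add: dist_norm norm_minus_commute)
  qed
  then show thesis using e by (intro that[of ?r]) auto
qed

context weak_gradient
begin

text \<open>The exceptional null set depends on \<open>y\<close>, so a representative of
  \<open>u\<close> cannot be read off here by fixing \<open>z\<close> and varying
  \<open>y\<close>.\<close>

lemma AE_increment:
  assumes "\<And>z s. z \<in> cbox p q \<Longrightarrow> 0 \<le> s \<Longrightarrow> s \<le> 1 \<Longrightarrow> z + s *\<^sub>R y \<in> \<Omega>"
  shows "AE z in lborel. z \<in> box p q \<longrightarrow> u (z + y) - u z - increment h z y = 0"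
proof (rule AE_zero_of_bump_integrals)
  show "(\<lambda>z. u (z + y) - u z - increment h z y) \<in> borel_measurable borel" by measurable
  show "\<bar>u (z + y) - u z - increment h z y\<bar> \<le> 2 * C + (\<Sum>j\<in>UNIV. \<bar>y $ j\<bar>) * C" for z
    using u_bound[of z] u_bound[of "z + y"] increment_bound[of z y] by linarith
  show "(LBINT z. (u (z + y) - u z - increment h z y) * bump m a b z) = 0"
    if "m > 0" and sub: "cbox a b \<subseteq> cbox p q" for m a b
  proof -
    have "cbox (a + s *\<^sub>R y) (b + s *\<^sub>R y) \<subseteq> \<Omega>" if "0 \<le> s" "s \<le> 1" for s
    proof
      fix x assume "x \<in> cbox (a + s *\<^sub>R y) (b + s *\<^sub>R y)"
      then have "x - s *\<^sub>R y \<in> cbox p q" using sub by (auto simp: mem_cbox_translate)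
      from assms[OF this that] show "x \<in> \<Omega>" by simp
    qed
    from integral_increment[OF \<open>m > 0\<close> this] show ?thesis by (simp add: mult.commute)
  qed
qed

lemma continuous_on_increment:
  assumes "\<And>z s. z \<in> S \<Longrightarrow> 0 \<le> s \<Longrightarrow> s \<le> 1 \<Longrightarrow> z + s *\<^sub>R y \<in> \<Omega>"
  shows "continuous_on S (\<lambda>z. increment h z y)"
  unfolding increment_def
proof (rule continuous_on_integral_dominated)
  let ?B = "(\<Sum>j\<in>UNIV. \<bar>y $ j\<bar>) * C"
  have B: "0 \<le> ?B" using C_nonneg by (simp add: sum_nonneg)
  show "integrable lborel (\<lambda>s. indicator {0..1::real} s * ?B)"
    using B by (intro integrable_bounded_support[where S = "{0..1}" and C = ?B]) (auto simp: indicator_def)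
  show "\<bar>indicator {0..1} s * (\<Sum>j\<in>UNIV. y $ j * h j (z + s *\<^sub>R y))\<bar> \<le> indicator {0..1} s * ?B" for z s
    using integrand_bound by (simp add: indicator_def)
  show "continuous_on S (\<lambda>z. indicator {0..1} s * (\<Sum>j\<in>UNIV. y $ j * h j (z + s *\<^sub>R y)))" for s
  proof (cases "s \<in> {0..1}")
    case True
    have "continuous_on S (\<lambda>z. h j (z + s *\<^sub>R y))" for j
      using True assms by (intro continuous_on_compose2[OF h_cont] continuous_intros) auto
    then show ?thesis by (intro continuous_intros)
  qed simp
qed measurable

text \<open>Integrating \<open>u (z + y) - u z = increment h z y\<close> against a bump function of \<open>y\<close> expresses \<open>u z\<close>
  almost everywhere by a function that is continuous in \<open>z\<close>.\<close>

lemma local_representative: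
  assumes "x0 \<in> \<Omega>"
  obtains T g where "open T" "x0 \<in> T" "T \<subseteq> \<Omega>" "continuous_on T g"
    "\<And>j z. z \<in> T \<Longrightarrow> has_partial g j (h j z) z" "AE z in lborel. z \<in> T \<longrightarrow> u z = g z"
proof -
  obtain r2 where r2: "r2 > 0" "cbox (x0 - vec r2) (x0 + vec r2) \<subseteq> \<Omega>"
    using open_contains_cube[OF open_\<Omega> assms] .
  \<comment> \<open>\<open>z\<close> and \<open>y\<close> may each use half of the width, so that
    \<open>z + y\<close> stays in the large cube.\<close>
  define r where "r = r2 / 2"
  have r: "r > 0" using r2 by (simp add: r_def)
  define Q where "Q = box (x0 - vec r) (x0 + vec r)"
  define Qc where "Qc = cbox (x0 - vec r) (x0 + vec r)"
  define K where "K = cbox (x0 - vec r2) (x0 + vec r2)"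
  define Y where "Y = cbox (0 - vec r) (0 + vec r :: real^'n)"
  have Y_iff: "y \<in> Y \<longleftrightarrow> (\<forall>i. \<bar>y $ i\<bar> \<le> r)" for y
    unfolding Y_def mem_cube by simp
  have openQ: "open Q" by (simp add: Q_def open_box)
  have QQc: "Q \<subseteq> Qc" unfolding Q_def Qc_def by (rule box_subset_cbox)
  have K\<Omega>: "K \<subseteq> \<Omega>" using r2 by (simp add: K_def)
  have in_K: "z + y \<in> K" if "z \<in> Qc" "y \<in> Y" for z y
    unfolding K_def mem_cube
  proof
    fix i
    have "\<bar>z $ i - x0 $ i\<bar> \<le> r" "\<bar>y $ i\<bar> \<le> r" using that by (auto simp: Qc_def Y_iff mem_cube)
    then show "\<bar>(z + y) $ i - x0 $ i\<bar> \<le> r2"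
      unfolding vector_add_component r_def by arith
  qed
  have Y_scale: "s *\<^sub>R y \<in> Y" if "y \<in> Y" "0 \<le> s" "s \<le> 1" for s y
    unfolding Y_iff
  proof
    fix i
    have "\<bar>y $ i\<bar> \<le> r" using that by (auto simp: Y_iff)
    moreover have "\<bar>s * y $ i\<bar> \<le> \<bar>y $ i\<bar>" using that by (simp add: abs_mult mult_left_le_one_le)
    ultimately show "\<bar>(s *\<^sub>R y) $ i\<bar> \<le> r" by simp
  qed
  have in_\<Omega>: "z + s *\<^sub>R y \<in> \<Omega>" if "z \<in> Qc" "y \<in> Y" "0 \<le> s" "s \<le> 1" for z y s
    using in_K[OF that(1) Y_scale[OF that(2-4)]] K\<Omega> by blast
  define \<psi> where "\<psi> = bump 1 (0 - vec r) (0 + vec r :: real^'n)"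
  have \<psi>_out: "\<psi> y = 0" if "y \<notin> Y" for y
    using bump_outside[of 1 y "0 - vec r" "0 + vec r"] that box_subset_cbox[of "0 - vec r" "0 + vec r :: real^'n"]
    by (auto simp: \<psi>_def Y_def)
  have \<psi>_le: "\<bar>\<psi> y\<bar> \<le> 1" for y unfolding \<psi>_def by (rule abs_bump_le_1)
  have \<psi>_meas [measurable]: "\<psi> \<in> borel_measurable borel" unfolding \<psi>_def by measurable
  define D where "D = (real CARD('n) * r) * C"
  have D0: "0 \<le> D" using r C_nonneg by (simp add: D_def)
  have incr_D: "\<bar>increment h z y\<bar> \<le> D" if "y \<in> Y" for z y
  proof -
    have "(\<Sum>j\<in>UNIV. \<bar>y $ j\<bar>) \<le> (\<Sum>j\<in>(UNIV::'n set). r)"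
      using that by (intro sum_mono) (simp add: Y_iff)
    then have "(\<Sum>j\<in>UNIV. \<bar>y $ j\<bar>) * C \<le> D"
      unfolding D_def using C_nonneg by (intro mult_right_mono) simp_all
    then show ?thesis using increment_bound[of z y] by linarith
  qed
  have bdY: "bounded Y" by (simp add: Y_def bounded_cbox)
  define I where "I = (LBINT y. \<psi> y)"
  have int_\<psi>: "integrable lborel \<psi>"
    using \<psi>_le \<psi>_out bdY by (intro integrable_bounded_support[where C = 1 and S = Y]) auto
  \<comment> \<open>A nonnegative continuous weight with integral 0 would vanish at 0, where the
    bump is positive.\<close>
  have I: "I > 0"
  proof -
    have "I \<ge> 0" unfolding I_def \<psi>_def by (intro Bochner_Integration.integral_nonneg bump_nonneg)
    moreover have "I \<noteq> 0"
    proof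
      assume "I = 0"
      then have "AE y in lborel. \<psi> y = 0"
        using integral_nonneg_eq_0_iff_AE[OF int_\<psi>] unfolding I_def \<psi>_def by (simp add: bump_nonneg)
      then have "AE y in lborel. y \<in> box (0 - vec r) (0 + vec r) \<longrightarrow> \<psi> y = 0" by (rule eventually_mono) simp
      moreover have "(0::real^'n) \<in> box (0 - vec r) (0 + vec r)" unfolding mem_cube using r by simp
      ultimately have "\<psi> 0 = 0"
        unfolding \<psi>_def by (intro continuous_AE_eq_0[OF open_box continuous_on_bump])
      then show False
        using bump_pos[of 1, OF _ \<open>0 \<in> box (0 - vec r) (0 + vec r)\<close>] by (simp add: \<psi>_def)
    qed
    ultimately show ?thesis by simp
  qed
  \<comment> \<open>If the increment formula held for all \<open>y\<close> in \<open>Y\<close>, this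
    would be exactly \<open>I * u z\<close>.\<close>
  define F where "F z = (LBINT y. \<psi> y * (u (z + y) - increment h z y))" for z
  have F_int: "integrable lborel (\<lambda>y. \<psi> y * u (z + y))" "integrable lborel (\<lambda>y. \<psi> y * increment h z y)" for z
  proof -
    show "integrable lborel (\<lambda>y. \<psi> y * u (z + y))"
    proof (rule integrable_bounded_support[where C = "1 * C" and S = Y])
      show "\<bar>\<psi> y * u (z + y)\<bar> \<le> 1 * C" for y
        unfolding abs_mult using \<psi>_le u_bound C_nonneg by (intro mult_mono) auto
    qed (use bdY \<psi>_out in auto)
    show "integrable lborel (\<lambda>y. \<psi> y * increment h z y)"
    proof (rule integrable_bounded_support[where C = "1 * D" and S = Y])
      show "\<bar>\<psi> y * increment h z y\<bar> \<le> 1 * D" for y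
      proof (cases "y \<in> Y")
        case True
        then show ?thesis
          unfolding abs_mult using \<psi>_le incr_D D0 by (intro mult_mono) auto
      qed (simp add: \<psi>_out D0)
    qed (use bdY \<psi>_out in auto)
  qed
  have F_meas [measurable]: "F \<in> borel_measurable borel"
  proof -
    have "(\<lambda>(z, y). \<psi> y * (u (z + y) - increment h z y)) \<in> borel_measurable (borel \<Otimes>\<^sub>M lborel)"
      by measurable
    from lborel.borel_measurable_lebesgue_integral[OF this] show ?thesis by (simp add: F_def[abs_def])
  qed
  \<comment> \<open>The identity is tested against bumps in \<open>z\<close> and the integrals are
    exchanged, so that \<open>integral_increment\<close> applies at each fixed \<open>y\<close> and
    no null set depending on \<open>y\<close> occurs.\<close>
  have "AE z in lborel. z \<in> Q \<longrightarrow> F z - I * u z = 0"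
    unfolding Q_def
  proof (rule AE_zero_of_bump_integrals)
    have F_bound: "\<bar>F z\<bar> \<le> (C + D) * I" for z
    proof -
      have "\<bar>F z\<bar> \<le> (LBINT y. \<bar>\<psi> y * (u (z + y) - increment h z y)\<bar>)"
        unfolding F_def by (rule integral_abs_bound)
      also have "\<dots> \<le> (LBINT y. (C + D) * \<psi> y)"
      proof (rule Bochner_Integration.integral_mono)
        show "integrable lborel (\<lambda>y. \<bar>\<psi> y * (u (z + y) - increment h z y)\<bar>)"
          using F_int[of z] by (auto simp: right_diff_distrib)
        show "integrable lborel (\<lambda>y. (C + D) * \<psi> y)" using int_\<psi> by simp
        show "\<bar>\<psi> y * (u (z + y) - increment h z y)\<bar> \<le> (C + D) * \<psi> y" for y
        proof (cases "y \<in> Y")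
          case True
          have "\<bar>u (z + y) - increment h z y\<bar> \<le> C + D"
            using u_bound[of "z + y"] incr_D[OF True, of z] by linarith
          moreover have "\<psi> y \<ge> 0" unfolding \<psi>_def by (rule bump_nonneg)
          ultimately show ?thesis by (simp add: abs_mult mult.commute mult_left_mono)
        qed (simp add: \<psi>_out)
      qed
      finally show ?thesis by (simp add: I_def)
    qed
    have Iu_bound: "\<bar>I * u z\<bar> \<le> I * C" for z
      using I u_bound[of z] by (simp add: abs_mult)
    show "\<bar>F z - I * u z\<bar> \<le> (C + D) * I + I * C" for z
      using F_bound[of z] Iu_bound[of z] abs_triangle_ineq4[of "F z" "I * u z"] by linarith
    fix m a b
    assume m: "m > (0::real)" and ab: "cbox a b \<subseteq> cbox (x0 - vec r) (x0 + vec r)"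
    let ?\<phi> = "bump m a b"
    let ?W = "\<lambda>z y. u (z + y) - u z - increment h z y"
    have \<phi>_out: "?\<phi> z = 0" if "z \<notin> cbox a b" for z
      using bump_outside[OF m] that box_subset_cbox[of a b] by blast
    have W: "F z - I * u z = (LBINT y. \<psi> y * ?W z y)" for z
    proof -
      have "(LBINT y. \<psi> y * ?W z y) = (LBINT y. \<psi> y * u (z + y) - \<psi> y * increment h z y - \<psi> y * u z)"
        by (simp add: algebra_simps)
      also have "\<dots> = (LBINT y. \<psi> y * u (z + y)) - (LBINT y. \<psi> y * increment h z y) - (LBINT y. \<psi> y * u z)"
        using F_int[of z] int_\<psi> by simp
      also have "\<dots> = F z - I * u z"
        using F_int[of z] by (simp add: F_def I_def right_diff_distrib)
      finally show ?thesis ..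
    qed
    have "(F z - I * u z) * ?\<phi> z = (LBINT y. \<psi> y * (?\<phi> z * ?W z y))" for z
      unfolding W mult.commute[of _ "?\<phi> z"] mult.left_commute[of "\<psi> _"]
      by (rule Bochner_Integration.integral_mult_right_zero[symmetric])
    then have "(LBINT z. (F z - I * u z) * ?\<phi> z) = (LBINT z. LBINT y. \<psi> y * (?\<phi> z * ?W z y))"
      by (simp only:)
    also have "\<dots> = (LBINT y. LBINT z. \<psi> y * (?\<phi> z * ?W z y))"
    proof (rule Fubini_bounded_support[where S = "cbox a b" and T = Y and C = "1 * (1 * (2 * C + D))"])
      show "(\<lambda>(z, y). \<psi> y * (?\<phi> z * ?W z y)) \<in> borel_measurable borel"
        unfolding borel_prod[symmetric] by measurable
      show "\<bar>\<psi> y * (?\<phi> z * ?W z y)\<bar> \<le> 1 * (1 * (2 * C + D))" for z y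
      proof (cases "y \<in> Y")
        case True
        have "\<bar>?W z y\<bar> \<le> 2 * C + D"
          using u_bound[of z] u_bound[of "z + y"] incr_D[OF True, of z] by linarith
        then show ?thesis
          unfolding abs_mult using \<psi>_le abs_bump_le_1 by (intro mult_mono) auto
      next
        case False
        then show ?thesis using C_nonneg D0 by (simp add: \<psi>_out)
      qed
      show "\<psi> y * (?\<phi> z * ?W z y) = 0" if "z \<notin> cbox a b \<or> y \<notin> Y" for z y
        using that \<psi>_out \<phi>_out by auto
    qed (simp_all add: bdY bounded_cbox)
    also have "\<dots> = (LBINT y::real^'n. 0)"
    proof (rule Bochner_Integration.integral_cong[OF refl])
      fix y
      show "(LBINT z. \<psi> y * (?\<phi> z * ?W z y)) = 0"
      proof (cases "y \<in> Y")
        case True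
        have "cbox (a + s *\<^sub>R y) (b + s *\<^sub>R y) \<subseteq> \<Omega>" if s: "0 \<le> s" "s \<le> 1" for s
        proof
          fix x assume "x \<in> cbox (a + s *\<^sub>R y) (b + s *\<^sub>R y)"
          then have "x - s *\<^sub>R y \<in> Qc" using ab by (auto simp: mem_cbox_translate Qc_def)
          from in_\<Omega>[OF this True s] show "x \<in> \<Omega>" by simp
        qed
        from integral_increment[OF m this] show ?thesis by simp
      qed (simp add: \<psi>_out)
    qed
    finally show "(LBINT z. (F z - I * u z) * ?\<phi> z) = 0" by simp
  qed measurable
  then have u_F: "AE z in lborel. z \<in> Q \<longrightarrow> u z = F z / I"
    by (rule eventually_mono) (use I in \<open>auto simp: field_simps\<close>)
  have F_cont: "continuous_on Q F"
  proof -
    \<comment> \<open>Substituting \<open>x = z + y\<close> shifts the dependence on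
      \<open>z\<close> from \<open>u\<close> to the continuous weight.\<close>
    have "F z = (LBINT x. \<psi> (x - z) * u x) - (LBINT y. \<psi> y * increment h z y)" for z
    proof -
      have "(LBINT x. \<psi> (x - z) * u x) = (LBINT y. \<psi> (y + z - z) * u (y + z))"
        by (intro integral_lborel_translate[symmetric]) measurable
      then show ?thesis
        using F_int[of z] by (simp add: F_def right_diff_distrib add.commute)
    qed
    moreover have "continuous_on Q (\<lambda>z. LBINT x. \<psi> (x - z) * u x)"
    proof (rule continuous_on_integral_dominated)
      show "integrable lborel (\<lambda>x. C * indicator K x)"
        using C_nonneg by (intro integrable_bounded_support[where C = C and S = K])
          (auto simp: indicator_def K_def bounded_cbox)
      show "\<bar>\<psi> (x - z) * u x\<bar> \<le> C * indicator K x" if "z \<in> Q" for z x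
      proof (cases "x - z \<in> Y")
        case True
        then have "x \<in> K" using in_K[of z "x - z"] that QQc by auto
        moreover have "\<bar>\<psi> (x - z)\<bar> * \<bar>u x\<bar> \<le> 1 * C"
          using \<psi>_le u_bound by (intro mult_mono) auto
        ultimately show ?thesis by (simp add: abs_mult)
      next
        case False
        then show ?thesis using C_nonneg by (simp add: \<psi>_out)
      qed
      show "continuous_on Q (\<lambda>z. \<psi> (x - z) * u x)" for x
        unfolding \<psi>_def by (intro continuous_intros continuous_on_compose2[OF continuous_on_bump]) auto
    qed measurable
    moreover have "continuous_on Q (\<lambda>z. LBINT y. \<psi> y * increment h z y)"
    proof (rule continuous_on_integral_dominated)
      show "integrable lborel (\<lambda>y. D * indicator Y y)"
        using D0 bdY by (intro integrable_bounded_support[where C = D and S = Y])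
          (auto simp: indicator_def Y_def)
      show "\<bar>\<psi> y * increment h z y\<bar> \<le> D * indicator Y y" for z y
      proof (cases "y \<in> Y")
        case True
        have "\<bar>\<psi> y\<bar> * \<bar>increment h z y\<bar> \<le> 1 * D"
          using \<psi>_le incr_D[OF True] by (intro mult_mono) auto
        then show ?thesis using True by (simp add: abs_mult)
      qed (simp add: \<psi>_out)
      show "continuous_on Q (\<lambda>z. \<psi> y * increment h z y)" for y
      proof (cases "y \<in> Y")
        case True
        then show ?thesis
          using in_\<Omega> QQc by (intro continuous_on_mult_left continuous_on_increment) blast
      qed (simp add: \<psi>_out)
    qed measurable
    ultimately show ?thesis by (simp add: continuous_on_diff)
  qed
  define g where "g z = F z / I" for z
  have g_cont: "continuous_on Q g"
    using F_cont unfolding g_def using I by (intro continuous_intros) auto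
  have g_meas [measurable]: "g \<in> borel_measurable borel" unfolding g_def by measurable
  \<comment> \<open>Another halving: \<open>z + y\<close> remains in \<open>Q\<close>, where
    \<open>g\<close> is continuous, for all \<open>z\<close> in \<open>T\<close> and small
    \<open>y\<close>.\<close>
  define T where "T = box (x0 - vec (r / 2)) (x0 + vec (r / 2))"
  have TQ: "T \<subseteq> Q"
  proof
    fix x assume "x \<in> T"
    then have x: "\<bar>x $ i - x0 $ i\<bar> < r / 2" for i by (auto simp: T_def mem_cube)
    have "\<bar>x $ i - x0 $ i\<bar> < r" for i using x[of i] r by linarith
    then show "x \<in> Q" by (simp add: Q_def mem_cube)
  qed
  have openT: "open T" by (simp add: T_def open_box)
  \<comment> \<open>For fixed \<open>y\<close> the formula for \<open>u\<close> carries over to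
    \<open>g\<close> almost everywhere. Both sides are continuous on \<open>T\<close>, so it holds
    at every point of \<open>T\<close>.\<close>
  have g_increment: "g (z + y) - g z = increment h z y"
    if y: "\<And>i. \<bar>y $ i\<bar> < r / 2" and z: "z \<in> T" for y z
  proof -
    have yY: "y \<in> Y"
      unfolding Y_iff
    proof
      show "\<bar>y $ i\<bar> \<le> r" for i using y[of i] r by linarith
    qed
    have T_shift: "z + y \<in> Q" if "z \<in> T" for z
      unfolding Q_def mem_cube
    proof
      fix i
      have "\<bar>z $ i - x0 $ i\<bar> < r / 2" using that by (auto simp: T_def mem_cube)
      then show "\<bar>(z + y) $ i - x0 $ i\<bar> < r"
        using y[of i] unfolding vector_add_component by arith
    qed
    have "AE z in lborel. z \<in> Q \<longrightarrow> u (z + y) - u z - increment h z y = 0"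
      unfolding Q_def using in_\<Omega> yY by (intro AE_increment) (auto simp: Qc_def)
    moreover have "AE z in lborel. z \<in> Q \<longrightarrow> u z = g z" using u_F by (simp add: g_def)
    moreover from this have "AE z in lborel. z + y \<in> Q \<longrightarrow> u (z + y) = g (z + y)"
    proof (rule AE_lborel_translate)
      have "{x. x \<in> Q \<longrightarrow> u x = g x} = - Q \<union> {x. u x = g x}" by auto
      moreover have "{x. u x = g x} \<in> sets borel" by measurable
      ultimately show "{x. x \<in> Q \<longrightarrow> u x = g x} \<in> sets borel"
        using openQ by (simp add: borel_open borel_comp)
    qed
    ultimately have "AE z in lborel. z \<in> T \<longrightarrow> g (z + y) - g z - increment h z y = 0"
    proof eventually_elim
      case (elim z)
      then show ?case using TQ T_shift[of z] by auto
    qed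
    moreover have "continuous_on T (\<lambda>z. g (z + y) - g z - increment h z y)"
      using T_shift TQ QQc in_\<Omega> yY
      by (intro continuous_on_diff continuous_on_compose2[OF g_cont] continuous_on_increment
          continuous_on_subset[OF g_cont TQ] continuous_intros) blast+
    ultimately have "g (z + y) - g z - increment h z y = 0"
      using continuous_AE_eq_0[OF openT] z by blast
    then show ?thesis by simp
  qed
  have "has_partial g j (h j z) z" if z: "z \<in> T" for j z
  proof -
    \<comment> \<open>\<open>t * k t\<close> is the increment of \<open>g\<close> over
      \<open>t *\<^sub>R axis j 1\<close>, so \<open>k\<close> extends the difference quotient
      continuously to \<open>t = 0\<close>, with value \<open>h j z\<close>.\<close>
    define k where "k t = (LBINT s. indicator {0..1} s * h j (z + (s * t) *\<^sub>R axis j 1))" for t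
    let ?S = "{- (r / 2)<..<r / 2}"
    have "continuous_on ?S k"
      unfolding k_def
    proof (rule continuous_on_integral_dominated)
      show "integrable lborel (\<lambda>s. indicator {0..1::real} s * C)"
        using C_nonneg by (intro integrable_bounded_support[where C = C and S = "{0..1}"]) (auto simp: indicator_def)
      show "\<bar>indicator {0..1} s * h j (z + (s * t) *\<^sub>R axis j 1)\<bar> \<le> indicator {0..1} s * C" for s t
        using h_bound by (simp add: indicator_def)
      show "continuous_on ?S (\<lambda>t. indicator {0..1} s * h j (z + (s * t) *\<^sub>R axis j 1))" for s
      proof (cases "s \<in> {0..1}")
        case True
        have "z + (s * t) *\<^sub>R axis j 1 \<in> \<Omega>" if t: "t \<in> ?S" for t
        proof -
          have "t *\<^sub>R axis j 1 \<in> Y" unfolding Y_iff using t r by (auto simp: axis_def)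
          moreover have "z \<in> Qc" using z TQ QQc by blast
          ultimately have "z + s *\<^sub>R t *\<^sub>R axis j 1 \<in> \<Omega>" using True by (intro in_\<Omega>) auto
          then show ?thesis by simp
        qed
        then show ?thesis
          by (intro continuous_on_mult_left continuous_on_compose2[OF h_cont] continuous_intros) auto
      qed simp
    qed measurable
    then have "isCont k 0" using r by (simp add: continuous_on_eq_continuous_at)
    moreover have "k 0 = h j z" by (simp add: k_def)
    ultimately have "k \<midarrow>0\<rightarrow> h j z" by (simp add: isCont_def)
    moreover have "\<forall>\<^sub>F t in at 0. k t = (g (z + t *\<^sub>R axis j 1) - g z) / t"
    proof -
      have "\<forall>\<^sub>F t in at 0. t \<in> ?S - {0}" using r by (intro eventually_at_in_open) auto
      then show ?thesis
      proof (rule eventually_mono)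
        fix t assume t: "t \<in> ?S - {0}"
        have "g (z + t *\<^sub>R axis j 1) - g z = increment h z (t *\<^sub>R axis j 1)"
          using t r by (intro g_increment z) (auto simp: axis_def)
        also have "\<dots> = (LBINT s. t * (indicator {0..1} s * h j (z + (s * t) *\<^sub>R axis j 1)))"
          unfolding increment_def by (simp add: axis_def if_distrib if_distribR sum.delta mult_ac cong: if_cong)
        also have "\<dots> = t * k t" by (simp add: k_def)
        finally show "k t = (g (z + t *\<^sub>R axis j 1) - g z) / t" using t by simp
      qed
    qed
    ultimately have "((\<lambda>t. (g (z + t *\<^sub>R axis j 1) - g z) / t) \<longlongrightarrow> h j z) (at 0)"
      by (rule Lim_transform_eventually)
    then show ?thesis by (simp add: DERIV_def)
  qed
  moreover have "x0 \<in> T" unfolding T_def mem_cube using r by simp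
  moreover have "T \<subseteq> \<Omega>"
  proof
    fix z assume "z \<in> T"
    then have "z + 0 *\<^sub>R 0 \<in> \<Omega>" using TQ QQc r by (intro in_\<Omega>) (auto simp: Y_iff)
    then show "z \<in> \<Omega>" by simp
  qed
  moreover have "AE z in lborel. z \<in> T \<longrightarrow> u z = g z"
    using u_F by (rule eventually_mono) (use TQ in \<open>auto simp: g_def\<close>)
  ultimately show thesis
    using that[OF openT] continuous_on_subset[OF g_cont TQ] by blast
qed

text \<open>The local representatives agree with the essential limit of \<open>u\<close>, so they glue.\<close>

lemma global_representative:
  obtains g where "continuous_on \<Omega> g" "\<And>j z. z \<in> \<Omega> \<Longrightarrow> has_partial g j (h j z) z"
    "AE z in lborel. z \<in> \<Omega> \<longrightarrow> u z = g z"
proof -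
  \<comment> \<open>\<open>P x c\<close> says that \<open>c\<close> is the essential limit of
    \<open>u\<close> at \<open>x\<close>; it refers to no local representative.\<close>
  define P where "P x c \<longleftrightarrow> (\<forall>e>0. \<exists>T. open T \<and> x \<in> T \<and> (AE y in lborel. y \<in> T \<longrightarrow> \<bar>u y - c\<bar> < e))" for x c
  have unique: "c = d" if c: "P x c" and d: "P x d" for x c d
  proof (rule ccontr)
    assume "c \<noteq> d"
    then have e: "\<bar>c - d\<bar> / 2 > 0" by simp
    obtain T where T: "open T" "x \<in> T" "AE y in lborel. y \<in> T \<longrightarrow> \<bar>u y - c\<bar> < \<bar>c - d\<bar> / 2"
      using c e unfolding P_def by blast
    obtain T' where T': "open T'" "x \<in> T'" "AE y in lborel. y \<in> T' \<longrightarrow> \<bar>u y - d\<bar> < \<bar>c - d\<bar> / 2"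
      using d e unfolding P_def by blast
    \<comment> \<open>The two bounds exclude each other. Stating the absurdity as
      \<open>1 = 0\<close> lets \<open>continuous_AE_eq_0\<close> rule out that the nonempty open
      set \<open>T \<inter> T'\<close> is null.\<close>
    have "AE y in lborel. y \<in> T \<inter> T' \<longrightarrow> (1::real) = 0"
      using T(3) T'(3)
    proof eventually_elim
      case (elim y)
      show ?case
      proof
        assume "y \<in> T \<inter> T'"
        with elim have "\<bar>u y - d\<bar> < \<bar>c - d\<bar> / 2" "\<bar>u y - c\<bar> < \<bar>c - d\<bar> / 2" by auto
        then have "\<bar>u y - d\<bar> + \<bar>u y - c\<bar> < \<bar>c - d\<bar> / 2 + \<bar>c - d\<bar> / 2"
          by (rule add_strict_mono)
        moreover have "\<bar>c - d\<bar> \<le> \<bar>u y - d\<bar> + \<bar>u y - c\<bar>"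
          using abs_triangle_ineq4[of "u y - d" "u y - c"] by simp
        ultimately show "(1::real) = 0" by simp
      qed
    qed
    then have "(1::real) = 0"
      using T T' by (intro continuous_AE_eq_0[of "T \<inter> T'" "\<lambda>_. 1"]) auto
    then show False by simp
  qed
  define R where "R x T g \<longleftrightarrow> open T \<and> x \<in> T \<and> T \<subseteq> \<Omega> \<and> continuous_on T g \<and>
      (\<forall>j. \<forall>z\<in>T. has_partial g j (h j z) z) \<and> (AE z in lborel. z \<in> T \<longrightarrow> u z = g z)" for x T g
  have "\<exists>T g. R x T g" if x: "x \<in> \<Omega>" for x
  proof (rule local_representative[OF x])
    fix T g
    assume "open T" "x \<in> T" "T \<subseteq> \<Omega>" "continuous_on T g"
      "\<And>j z. z \<in> T \<Longrightarrow> has_partial g j (h j z) z" "AE z in lborel. z \<in> T \<longrightarrow> u z = g z"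
    then have "R x T g" unfolding R_def by blast
    then show ?thesis by blast
  qed
  then obtain T g where R: "\<And>x. x \<in> \<Omega> \<Longrightarrow> R x (T x) (g x)" by metis
  note Tg = R[unfolded R_def]
  define G where "G x = (SOME c. P x c)" for x
  have G: "G z = g x z" if x: "x \<in> \<Omega>" and z: "z \<in> T x" for x z
  proof -
    have "P z (g x z)" unfolding P_def
    proof (intro allI impI)
      fix e :: real assume "e > 0"
      let ?S = "T x \<inter> g x -` ball (g x z) e"
      have "open ?S" using Tg[OF x] by (intro continuous_open_preimage) auto
      moreover have "z \<in> ?S" using z \<open>e > 0\<close> by simp
      moreover have "AE y in lborel. y \<in> T x \<longrightarrow> u y = g x y" using Tg[OF x] by blast
      then have "AE y in lborel. y \<in> ?S \<longrightarrow> \<bar>u y - g x z\<bar> < e"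
        by (rule eventually_mono) (auto simp: dist_real_def abs_minus_commute)
      ultimately show "\<exists>S. open S \<and> z \<in> S \<and> (AE y in lborel. y \<in> S \<longrightarrow> \<bar>u y - g x z\<bar> < e)" by blast
    qed
    from unique[OF someI[of "P z", OF this] this] show ?thesis unfolding G_def .
  qed
  show thesis
  proof (rule that)
    show "continuous_on \<Omega> G"
    proof (rule continuous_at_imp_continuous_on, rule)
      fix x assume x: "x \<in> \<Omega>"
      have "continuous_on (T x) G"
        by (rule continuous_on_eq[of _ "g x"]) (use Tg[OF x] G[OF x] in auto)
      then show "isCont G x" using Tg[OF x] by (simp add: continuous_on_eq_continuous_at)
    qed
    show "has_partial G j (h j x) x" if x: "x \<in> \<Omega>" for j x
    proof -
      have "has_partial (g x) j (h j x) x" "open (T x)" "x \<in> T x" using Tg[OF x] by blast+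
      then show ?thesis using has_partial_cong[of "T x" x G "g x"] G[OF x] by blast
    qed
    \<comment> \<open>Countably many of the sets cover \<Omega>, so the union of their exceptional
      null sets is null.\<close>
    obtain D where D: "D \<subseteq> T ` \<Omega>" "countable D" "\<Union>D = \<Union>(T ` \<Omega>)"
      using Lindelof[of "T ` \<Omega>"] Tg by blast
    have "AE z in lborel. \<forall>S\<in>D. z \<in> S \<longrightarrow> u z = G z"
    proof (rule AE_ball_countable'[OF _ D(2)])
      fix S assume "S \<in> D"
      then obtain x where x: "x \<in> \<Omega>" "S = T x" using D(1) by blast
      have "AE z in lborel. z \<in> T x \<longrightarrow> u z = g x z" using Tg[OF x(1)] by blast
      then show "AE z in lborel. z \<in> S \<longrightarrow> u z = G z"
        by (rule eventually_mono) (use G[OF x(1)] x(2) in auto)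
    qed
    then show "AE z in lborel. z \<in> \<Omega> \<longrightarrow> u z = G z"
    proof (rule eventually_mono)
      fix z assume z: "\<forall>S\<in>D. z \<in> S \<longrightarrow> u z = G z"
      have "z \<in> \<Union>D" if "z \<in> \<Omega>" using that Tg[OF that] D(3) by blast
      then show "z \<in> \<Omega> \<longrightarrow> u z = G z" using z by blast
    qed
  qed
qed

lemma smooth_representative:
  assumes "\<And>j. smooth_real_on \<Omega> (h j)"
  obtains g where "smooth_real_on \<Omega> g" "AE z in lborel. z \<in> \<Omega> \<longrightarrow> u z = g z"
proof -
  obtain g where g: "continuous_on \<Omega> g" "\<And>j z. z \<in> \<Omega> \<Longrightarrow> has_partial g j (h j z) z"
    "AE z in lborel. z \<in> \<Omega> \<longrightarrow> u z = g z"
    using global_representative by blast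
  have "Ck m \<Omega> g" for m
  proof (cases m)
    case (Suc n)
    have "Ck n \<Omega> (h j)" for j using assms smooth_real_on_iff_Ck[OF open_\<Omega>] by blast
    then show ?thesis unfolding Suc by (rule Ck_SucI[OF g(1) _ g(2)])
  qed (simp add: g(1))
  then have "smooth_real_on \<Omega> g" using smooth_real_on_iff_Ck[OF open_\<Omega>] by blast
  then show thesis using g(3) by (rule that)
qed

end

section \<open>Smoothness of the map\<close>

lemma AE_lebesgue_on_iff:
  fixes \<Omega> :: "'a::euclidean_space set"
  assumes "open \<Omega>"
  shows "(AE x in lebesgue_on \<Omega>. P x) \<longleftrightarrow> (AE x in lborel. x \<in> \<Omega> \<longrightarrow> P x)"
  using assms by (simp add: AE_restrict_space_iff AE_completion_iff)

text \<open>Since \<theta> vanishes outside \<Omega>, the integral extends to the whole space, where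
  \<open>v\<close> can be replaced by the Borel function \<open>w\<close>, as
  \<open>weak_gradient\<close> requires.\<close>

lemma integral_lebesgue_on_eq_lborel:
  fixes \<Omega> :: "'a::euclidean_space set" and v w \<theta> :: "'a \<Rightarrow> real"
  assumes \<Omega>: "open \<Omega>" and v: "v \<in> borel_measurable (lebesgue_on \<Omega>)"
    and w: "w \<in> borel_measurable borel" and vw: "AE x in lborel. x \<in> \<Omega> \<longrightarrow> v x = w x"
    and \<theta>: "continuous_on UNIV \<theta>" "\<And>x. x \<notin> \<Omega> \<Longrightarrow> \<theta> x = 0"
  shows "(LINT x|lebesgue_on \<Omega>. v x * \<theta> x) = (LBINT x. w x * \<theta> x)"
proof -
  have \<theta>_meas: "\<theta> \<in> borel_measurable lborel"
    using borel_measurable_continuous_onI[OF \<theta>(1)] by simp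
  have "\<Omega> \<in> sets lebesgue" using \<Omega> by simp
  then have "(\<lambda>x. if x \<in> \<Omega> then v x else 0) \<in> borel_measurable lebesgue"
    using borel_measurable_if_I[OF v] by simp
  moreover have \<theta>_leb: "\<theta> \<in> borel_measurable lebesgue" using \<theta>_meas by (rule measurable_completion)
  ultimately have v_meas: "(\<lambda>x. (if x \<in> \<Omega> then v x else 0) * \<theta> x) \<in> borel_measurable lebesgue"
    by (rule borel_measurable_times)
  have w_meas: "(\<lambda>x. w x * \<theta> x) \<in> borel_measurable lborel"
    using w \<theta>_meas by simp
  have "(LINT x|lebesgue_on \<Omega>. v x * \<theta> x) = (LINT x|lebesgue. (if x \<in> \<Omega> then v x * \<theta> x else 0))"
    using Lebesgue_Measure.integral_restrict_UNIV[OF \<open>\<Omega> \<in> sets lebesgue\<close>, of "\<lambda>x. v x * \<theta> x"] by simp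
  also have "\<dots> = (LINT x|lebesgue. (if x \<in> \<Omega> then v x else 0) * \<theta> x)"
    by (intro Bochner_Integration.integral_cong refl) simp
  also have "\<dots> = (LINT x|lebesgue. w x * \<theta> x)"
  proof (rule Bochner_Integration.integral_cong_AE[OF v_meas measurable_completion[OF w_meas]])
    show "AE x in lebesgue. (if x \<in> \<Omega> then v x else 0) * \<theta> x = w x * \<theta> x"
      unfolding AE_completion_iff using vw by (rule eventually_mono) (auto simp: \<theta>(2))
  qed
  also have "\<dots> = (LBINT x. w x * \<theta> x)" by (rule integral_completion[OF w_meas])
  finally show ?thesis .
qed

lemma test_fun_continuous:
  assumes "test_fun \<Omega> \<phi>"
  shows "continuous_on UNIV \<phi>" "continuous_on UNIV (ipd [j] \<phi>)"
proof -
  have "continuous_on UNIV (ipd js \<phi>)" for js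
    using assms unfolding test_fun_def smooth_real_on_def by blast
  from this[of "[]"] this[of "[j]"]
  show "continuous_on UNIV \<phi>" "continuous_on UNIV (ipd [j] \<phi>)" by simp_all
qed

lemma test_fun_outside:
  assumes "test_fun \<Omega> \<phi>" "x \<notin> \<Omega>"
  shows "\<phi> x = 0" "ipd [j] \<phi> x = 0"
proof -
  obtain K where K: "compact K" "K \<subseteq> \<Omega>" "\<And>x. x \<notin> K \<Longrightarrow> \<phi> x = 0"
    using assms(1) unfolding test_fun_def by blast
  then have x: "x \<in> - K" using assms(2) by blast
  then show "\<phi> x = 0" using K(3) by simp
  have "has_partial \<phi> j 0 x \<longleftrightarrow> has_partial (\<lambda>_. 0) j 0 x"
    using K x by (intro has_partial_cong[of "- K"]) (auto simp: compact_imp_closed open_Compl)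
  then show "ipd [j] \<phi> x = 0" using DERIV_imp_deriv by simp
qed

lemma smooth_real_on_cong:
  assumes "open S" "\<And>x. x \<in> S \<Longrightarrow> f x = g x"
  shows "smooth_real_on S f \<longleftrightarrow> smooth_real_on S g"
  unfolding smooth_real_on_iff_Ck[OF assms(1)] using Ck_cong[OF assms] by simp

lemma smooth_real_on_imp_continuous_on: "smooth_real_on S g \<Longrightarrow> continuous_on S g"
  unfolding smooth_real_on_def by (metis ipd.simps(1))

section \<open>Exterior powers at every point\<close>

lemma AE_ex_in_open:
  fixes S :: "'a::euclidean_space set"
  assumes "AE x in lborel. x \<in> S \<longrightarrow> P x" "open S" "S \<noteq> {}"
  shows "\<exists>x\<in>S. P x"
proof (rule ccontr)
  assume "\<not> ?thesis"
  then have AE: "AE x in lborel. x \<in> S \<longrightarrow> (1::real) = 0"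
    by (intro eventually_mono[OF assms(1)]) auto
  obtain x where "x \<in> S" using assms(3) by blast
  from continuous_AE_eq_0[OF assms(2) continuous_on_const AE this] show False by simp
qed

text \<open>Good points accumulate at \<open>x\<close>. Their matrices lie in a compact set, and a
  subsequential limit works because minors are polynomials in the entries and \<open>F\<close> is
  continuous.\<close>

lemma ext_pow_closed:
  fixes F :: "real^('n::{finite,linorder}) \<Rightarrow> real^('n::{finite,linorder} set)^('n::{finite,linorder} set)"
  assumes \<Omega>: "open \<Omega>" and F: "\<And>I J. continuous_on \<Omega> (\<lambda>x. F x $ I $ J)"
    and AE: "AE x in lborel. x \<in> \<Omega> \<longrightarrow> ext_pow k (G x) = F x \<and> (\<forall>i j. \<bar>G x $ i $ j\<bar> \<le> C)"
    and x: "x \<in> \<Omega>"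
  shows "\<exists>A. ext_pow k A = F x \<and> (\<forall>i j. \<bar>A $ i $ j\<bar> \<le> C)"
proof -
  define S where "S = {A :: real^('n::{finite,linorder})^('n::{finite,linorder}). \<forall>i j. \<bar>A $ i $ j\<bar> \<le> C}"
  have "closed S"
    unfolding S_def by (intro closed_Collect_all closed_Collect_le continuous_intros)
  moreover have "bounded S"
    unfolding bounded_iff
  proof (intro exI ballI)
    fix A assume A: "A \<in> S"
    have "norm A \<le> (\<Sum>i\<in>UNIV. norm (A $ i))" 
      unfolding norm_vec_def by (rule L2_set_le_sum) simp
    also have "\<dots> \<le> (\<Sum>i\<in>(UNIV::'n set). \<Sum>j\<in>(UNIV::'n set). C)"
    proof (rule sum_mono)
      fix i
      have "norm (A $ i) \<le> (\<Sum>j\<in>UNIV. \<bar>A $ i $ j\<bar>)" by (rule norm_le_l1_cart)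
      also have "\<dots> \<le> (\<Sum>j\<in>(UNIV::'n set). C)" using A by (intro sum_mono) (simp add: S_def)
      finally show "norm (A $ i) \<le> (\<Sum>j\<in>(UNIV::'n set). C)" .
    qed
    finally show "norm A \<le> (\<Sum>i\<in>(UNIV::'n set). \<Sum>j\<in>(UNIV::'n set). C)" .
  qed
  ultimately have "compact S" by (simp add: compact_eq_bounded_closed)
  have "\<exists>y. y \<in> \<Omega> \<and> dist y x < inverse (real (Suc n)) \<and> ext_pow k (G y) = F y \<and> G y \<in> S" for n
  proof -
    define U where "U = \<Omega> \<inter> ball x (inverse (real (Suc n)))"
    have "AE y in lborel. y \<in> U \<longrightarrow> ext_pow k (G y) = F y \<and> G y \<in> S"
      using AE by (rule eventually_mono) (auto simp: S_def U_def)
    moreover have "open U" unfolding U_def using \<Omega> by (intro open_Int open_ball)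
    moreover have "x \<in> U" using x by (simp add: U_def)
    then have "U \<noteq> {}" by blast
    ultimately have "\<exists>y\<in>U. ext_pow k (G y) = F y \<and> G y \<in> S"
      by (rule AE_ex_in_open)
    then obtain y where "y \<in> U" "ext_pow k (G y) = F y" "G y \<in> S" by blast
    then show ?thesis by (intro exI[of _ y]) (simp add: U_def dist_commute)
  qed
  then have "\<forall>n. \<exists>y. y \<in> \<Omega> \<and> dist y x < inverse (real (Suc n)) \<and> ext_pow k (G y) = F y \<and> G y \<in> S" ..
  from choice[OF this] obtain X where X: "\<And>n. X n \<in> \<Omega>" "\<And>n. dist (X n) x < inverse (real (Suc n))"
    "\<And>n. ext_pow k (G (X n)) = F (X n)" "\<And>n. G (X n) \<in> S"
    by blast
  have "(\<lambda>n. dist (X n) x) \<longlonglongrightarrow> 0"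
  proof (rule tendsto_sandwich[OF _ _ tendsto_const LIMSEQ_inverse_real_of_nat])
    show "\<forall>\<^sub>F n in sequentially. dist (X n) x \<le> inverse (real (Suc n))"
      by (rule always_eventually) (intro allI less_imp_le X(2))
  qed simp
  then have "X \<longlonglongrightarrow> x" by (rule tendsto_dist_iff[THEN iffD2])
  have "seq_compact S" using \<open>compact S\<close> by (simp add: compact_eq_seq_compact_metric)
  moreover have "\<forall>n. (\<lambda>n. G (X n)) n \<in> S" using X(4) by simp
  ultimately obtain A r where A: "A \<in> S" "strict_mono r" "((\<lambda>n. G (X n)) \<circ> r) \<longlonglongrightarrow> A"
    by (rule seq_compactE)
  have "ext_pow k A $ I $ J = F x $ I $ J" for I J
  proof (rule LIMSEQ_unique)
    have "continuous_on UNIV (\<lambda>A :: real^('n::{finite,linorder})^('n::{finite,linorder}). ext_pow k A $ I $ J)"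
    proof (cases "card I = k \<and> card J = k")
      case True
      have "continuous_on UNIV (\<lambda>A :: real^('n::{finite,linorder})^('n::{finite,linorder}).
          \<Sum>p | p permutes {..<k}. of_int (sign p) *
            (\<Prod>i<k. A $ (sorted_list_of_set I ! p i) $ (sorted_list_of_set J ! i)))"
        by (intro continuous_on_sum continuous_on_mult_left continuous_on_prod continuous_on_component continuous_on_id)
      then show ?thesis using True by (simp add: ext_pow_def)
    qed (auto simp: ext_pow_def)
    then have "isCont (\<lambda>A. ext_pow k A $ I $ J) A"
      by (simp add: continuous_on_eq_continuous_at)
    from isCont_tendsto_compose[OF this A(3)[unfolded o_def]]
    show "(\<lambda>n. ext_pow k (G (X (r n))) $ I $ J) \<longlonglongrightarrow> ext_pow k A $ I $ J" .
    have "isCont (\<lambda>x. F x $ I $ J) x"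
      using F[of I J] \<Omega> x by (simp add: continuous_on_eq_continuous_at)
    moreover have "(\<lambda>n. X (r n)) \<longlonglongrightarrow> x"
      using LIMSEQ_subseq_LIMSEQ[OF \<open>X \<longlonglongrightarrow> x\<close> A(2)] by (simp add: o_def)
    ultimately have "(\<lambda>n. F (X (r n)) $ I $ J) \<longlonglongrightarrow> F x $ I $ J"
      by (rule isCont_tendsto_compose)
    then show "(\<lambda>n. ext_pow k (G (X (r n))) $ I $ J) \<longlonglongrightarrow> F x $ I $ J" by (simp add: X(3))
  qed
  then have "ext_pow k A = F x" by (simp add: Finite_Cartesian_Product.vec_eq_iff)
  then show ?thesis using A(1) by (auto simp: S_def)
qed

lemma W1inf_jac_smooth:
  assumes \<Omega>: "open \<Omega>" and W: "W1inf_jac \<Omega> f G"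
    and H: "smooth_mat_on \<Omega> H" "\<And>x i j. \<bar>H x $ i $ j\<bar> \<le> C" "\<And>x. x \<notin> \<Omega> \<Longrightarrow> H x = 0"
    and GH: "AE x in lborel. x \<in> \<Omega> \<longrightarrow> G x = H x"
  shows "\<exists>g. smooth_vec_on \<Omega> g \<and> (AE x in lebesgue_on \<Omega>. f x = g x)"
proof -
  have H_smooth: "smooth_real_on \<Omega> (\<lambda>x. H x $ i $ j)" for i j
    using H(1) unfolding smooth_mat_on_def by blast
  have H_cont: "continuous_on \<Omega> (\<lambda>x. H x $ i $ j)" for i j
    by (rule smooth_real_on_imp_continuous_on[OF H_smooth])
  \<comment> \<open>Continuity on \<Omega> and the value 0 outside give Borel measurability on the
    whole space.\<close>
  have H_meas: "(\<lambda>x. H x $ i $ j) \<in> borel_measurable borel" for i j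
  proof -
    have "(\<lambda>x. indicator \<Omega> x *\<^sub>R H x $ i $ j) \<in> borel_measurable borel"
      using \<Omega> by (intro borel_measurable_continuous_on_indicator H_cont) simp
    moreover have "(\<lambda>x. indicator \<Omega> x *\<^sub>R H x $ i $ j) = (\<lambda>x. H x $ i $ j)"
    proof
      show "indicator \<Omega> x *\<^sub>R H x $ i $ j = H x $ i $ j" for x
        by (cases "x \<in> \<Omega>") (simp_all add: H(3))
    qed
    ultimately show ?thesis by (simp only:)
  qed
  have "\<exists>g. smooth_real_on \<Omega> g \<and> (AE x in lborel. x \<in> \<Omega> \<longrightarrow> f x $ i = g x)" for i
  proof -
    have f_meas: "(\<lambda>x. f x $ i) \<in> borel_measurable (lebesgue_on \<Omega>)"
      using W unfolding W1inf_jac_def by blast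
    obtain Cf where Cf: "AE x in lebesgue_on \<Omega>. \<bar>f x $ i\<bar> \<le> Cf"
      using W unfolding W1inf_jac_def by blast
    have "(\<lambda>x. if x \<in> \<Omega> then f x $ i else 0) \<in> borel_measurable lebesgue"
      using borel_measurable_if_I[OF f_meas] \<Omega> by simp
    from completion_ex_borel_measurable_real[OF this] obtain v where
      v: "v \<in> borel_measurable lborel" "AE x in lborel. (if x \<in> \<Omega> then f x $ i else 0) = v x"
      by blast
    define B where "B = max \<bar>Cf\<bar> \<bar>C\<bar>"
    \<comment> \<open>\<open>v\<close> agrees with the component of \<open>f\<close> only almost
      everywhere in \<Omega>. Clamping makes the bound hold at every point and preserves that
      agreement.\<close>
    define u where "u x = max (- B) (min B (v x))" for x
    have u_meas: "u \<in> borel_measurable borel" using v(1) unfolding u_def by simp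
    have fu: "AE x in lborel. x \<in> \<Omega> \<longrightarrow> f x $ i = u x"
      using v(2) Cf[unfolded AE_lebesgue_on_iff[OF \<Omega>]]
    proof eventually_elim
      case (elim x)
      show ?case
      proof
        assume "x \<in> \<Omega>"
        with elim have "f x $ i = v x" "\<bar>f x $ i\<bar> \<le> B" by (auto simp: B_def)
        then show "f x $ i = u x" by (auto simp: u_def abs_le_iff)
      qed
    qed
    have B0: "0 \<le> B" by (simp add: B_def le_max_iff_disj)
    have "weak_gradient \<Omega> u (\<lambda>j x. H x $ i $ j) B"
    proof (rule weak_gradient.intro[OF \<Omega> u_meas _ H_meas _ H_cont])
      show "\<bar>u x\<bar> \<le> B" for x
        using B0 by (auto simp: u_def max_def min_def abs_le_iff)
      show "\<bar>H x $ i $ j\<bar> \<le> B" for j x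
        using H(2)[of x i j] abs_ge_self[of C] unfolding B_def by (simp add: le_max_iff_disj)
      fix \<phi> j assume \<phi>: "test_fun \<Omega> \<phi>"
      have "(LINT x|lebesgue_on \<Omega>. f x $ i * ipd [j] \<phi> x) = - (LINT x|lebesgue_on \<Omega>. G x $ i $ j * \<phi> x)"
        using W \<phi> unfolding W1inf_jac_def by blast
      moreover have "(LINT x|lebesgue_on \<Omega>. f x $ i * ipd [j] \<phi> x) = (LBINT x. u x * ipd [j] \<phi> x)"
        by (rule integral_lebesgue_on_eq_lborel[OF \<Omega> f_meas u_meas fu test_fun_continuous(2)[OF \<phi>] test_fun_outside(2)[OF \<phi>]])
      moreover have "(LINT x|lebesgue_on \<Omega>. G x $ i $ j * \<phi> x) = (LBINT x. H x $ i $ j * \<phi> x)"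
      proof (rule integral_lebesgue_on_eq_lborel[OF \<Omega> _ H_meas _ test_fun_continuous(1)[OF \<phi>] test_fun_outside(1)[OF \<phi>]])
        show "(\<lambda>x. G x $ i $ j) \<in> borel_measurable (lebesgue_on \<Omega>)"
          using W unfolding W1inf_jac_def by blast
        show "AE x in lborel. x \<in> \<Omega> \<longrightarrow> G x $ i $ j = H x $ i $ j"
          using GH by (rule eventually_mono) simp
      qed
      ultimately show "(LBINT x. u x * ipd [j] \<phi> x) = - (LBINT x. H x $ i $ j * \<phi> x)" by simp
    qed
    from weak_gradient.smooth_representative[OF this H_smooth]
    obtain g where g: "smooth_real_on \<Omega> g" "AE x in lborel. x \<in> \<Omega> \<longrightarrow> u x = g x"
      by blast
    have "AE x in lborel. x \<in> \<Omega> \<longrightarrow> f x $ i = g x"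
      using fu g(2) by eventually_elim simp
    then show ?thesis using g(1) by blast
  qed
  then have "\<forall>i. \<exists>g. smooth_real_on \<Omega> g \<and> (AE x in lborel. x \<in> \<Omega> \<longrightarrow> f x $ i = g x)" ..
  from choice[OF this] obtain g where
    g: "\<And>i. smooth_real_on \<Omega> (g i)" "\<And>i. AE x in lborel. x \<in> \<Omega> \<longrightarrow> f x $ i = g i x"
    by blast
  have "AE x in lborel. \<forall>i. x \<in> \<Omega> \<longrightarrow> f x $ i = g i x"
    by (rule eventually_all_finite) (rule g(2))
  then have "AE x in lebesgue_on \<Omega>. f x = (\<chi> i. g i x)"
    unfolding AE_lebesgue_on_iff[OF \<Omega>]
    by (rule eventually_mono) (simp add: Finite_Cartesian_Product.vec_eq_iff)
  moreover have "smooth_vec_on \<Omega> (\<lambda>x. \<chi> i. g i x)" using g(1) by (simp add: smooth_vec_on_def)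
  ultimately show ?thesis by blast
qed

theorem mainTheorem14:
  fixes \<Omega> :: "(real^('n::{finite,linorder})) set"
    and f :: "real^('n::{finite,linorder}) \<Rightarrow> real^('n::{finite,linorder})"
    and G :: "real^('n::{finite,linorder}) \<Rightarrow> real^('n::{finite,linorder})^('n::{finite,linorder})"
    and k :: nat
  assumes "CARD('n) > 2"
    and "open \<Omega>"
    and "odd k" and "2 \<le> k" and "k \<le> CARD('n) - 1"
    and "W1inf_jac \<Omega> f G"
    and "\<exists>F :: real^('n::{finite,linorder}) \<Rightarrow> real^('n::{finite,linorder} set)^('n::{finite,linorder} set).
           smooth_mat_on \<Omega> F \<and>
           (AE x in lebesgue_on \<Omega>. ext_pow k (G x) = F x) \<and>
           (\<forall>x\<in>\<Omega>. is_ext_endo k (F x) \<and> rank (F x) > k)"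
  shows "\<exists>g. smooth_vec_on \<Omega> g \<and> (AE x in lebesgue_on \<Omega>. f x = g x)"
proof -
  note \<Omega> = \<open>open \<Omega>\<close>
  obtain F :: "real^('n::{finite,linorder}) \<Rightarrow> real^('n::{finite,linorder} set)^('n::{finite,linorder} set)"
    where F: "smooth_mat_on \<Omega> F" "AE x in lebesgue_on \<Omega>. ext_pow k (G x) = F x"
      "\<And>x. x \<in> \<Omega> \<Longrightarrow> rank (F x) > k"
    using assms(7) by blast
  have "\<forall>i. \<forall>j. \<exists>C. AE x in lborel. x \<in> \<Omega> \<longrightarrow> \<bar>G x $ i $ j\<bar> \<le> C"
    using assms(6) unfolding W1inf_jac_def AE_lebesgue_on_iff[OF \<Omega>] by blast
  then obtain B where B: "\<And>i j. AE x in lborel. x \<in> \<Omega> \<longrightarrow> \<bar>G x $ i $ j\<bar> \<le> B i j"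
    unfolding choice_iff by blast
  define C where "C = (\<Sum>i\<in>UNIV. \<Sum>j\<in>UNIV. \<bar>B i j\<bar>)"
  have C0: "0 \<le> C" unfolding C_def by (intro sum_nonneg) simp
  have BC: "B i j \<le> C" for i j
  proof -
    have "B i j \<le> \<bar>B i j\<bar>" by (rule abs_ge_self)
    also have "\<dots> \<le> (\<Sum>j\<in>UNIV. \<bar>B i j\<bar>)" by (rule member_le_sum) auto
    also have "\<dots> \<le> C" unfolding C_def by (rule member_le_sum) (auto intro: sum_nonneg)
    finally show ?thesis .
  qed
  have "AE x in lborel. \<forall>i j. x \<in> \<Omega> \<longrightarrow> \<bar>G x $ i $ j\<bar> \<le> B i j"
    by (intro eventually_all_finite B)
  then have good: "AE x in lborel. x \<in> \<Omega> \<longrightarrow> ext_pow k (G x) = F x \<and> (\<forall>i j. \<bar>G x $ i $ j\<bar> \<le> C)"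
    using F(2)[unfolded AE_lebesgue_on_iff[OF \<Omega>]]
    by eventually_elim (use BC order_trans in blast)
  have F_cont: "continuous_on \<Omega> (\<lambda>x. F x $ I $ J)" for I J
    using F(1) smooth_real_on_imp_continuous_on unfolding smooth_mat_on_def by blast
  define Q where "Q x A \<longleftrightarrow> ext_pow k A = F x \<and> (\<forall>i j. \<bar>A $ i $ j\<bar> \<le> C)" for x A
  \<comment> \<open>\<open>G x\<close> is kept wherever it is admissible, so \<open>H = G\<close>
    almost everywhere in \<Omega>; at the other points of \<Omega> an arbitrary bounded preimage of
    \<open>F x\<close> is taken. \<open>smooth_of_smooth_ext_pow\<close> makes \<open>H\<close>
    smooth however the choice falls.\<close>
  define H where "H x = (if x \<in> \<Omega> then if Q x (G x) then G x else (SOME A. Q x A) else 0)" for x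
  have QH: "Q x (H x)" if "x \<in> \<Omega>" for x
  proof -
    have "\<exists>A. Q x A" unfolding Q_def by (rule ext_pow_closed[OF \<Omega> F_cont good that])
    then have "Q x (SOME A. Q x A)" by (rule someI_ex)
    then show ?thesis using that by (simp add: H_def)
  qed
  have "smooth_real_on \<Omega> (\<lambda>x. ext_pow k (H x) $ I $ J) \<longleftrightarrow> smooth_real_on \<Omega> (\<lambda>x. F x $ I $ J)" for I J
    by (rule smooth_real_on_cong[OF \<Omega>]) (use QH in \<open>simp add: Q_def\<close>)
  then have "smooth_mat_on \<Omega> (\<lambda>x. ext_pow k (H x))" using F(1) by (simp add: smooth_mat_on_def)
  moreover have "rank (ext_pow k (H x)) > k" if "x \<in> \<Omega>" for x
    using QH[OF that] F(3)[OF that] by (simp add: Q_def)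
  ultimately have "smooth_mat_on \<Omega> H"
    by (rule smooth_of_smooth_ext_pow[OF \<open>odd k\<close> \<Omega>])
  moreover have "\<bar>H x $ i $ j\<bar> \<le> C" for x i j
    using QH[of x] C0 by (cases "x \<in> \<Omega>") (auto simp: Q_def H_def)
  moreover have "H x = 0" if "x \<notin> \<Omega>" for x
    using that by (simp add: H_def)
  moreover have "AE x in lborel. x \<in> \<Omega> \<longrightarrow> G x = H x"
    using good by (rule eventually_mono) (simp add: H_def Q_def)
  ultimately show ?thesis
    by (rule W1inf_jac_smooth[OF \<Omega> assms(6)])
qed

end
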